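(* Let $\omega>0$, $\nu\ge0$, $\epsilon>0$ with $\omega^2+\nu^2+\epsilon^2=1$, and let $\lambda_1,\lambda_2,c,d,\mu_2,\alpha,\beta_2,\gamma$ be as in the context. Define $$\mathcal L=(\lambda_2cd-d\lambda_1^{-1})x_1+\lambda_2D_{x_2}-i\mu_2\lambda_1d^{-1}D_{x_1}-i\mu_2c\lambda_1x_2,\qquad LLL=(\ker\mathcal L)\cap L^2(\mathbb R^2).$$ Then $LLL$ is the subspace of $L^2(\mathbb R^2)$ of functions of the form $$F(x_1+i\beta_2x_2)\exp\left(-\frac{\gamma\pi}{4\beta_2}\Bigl[x_1^2\bigl(1-\tfrac{\nu^2}{2\alpha}\bigr)+(\beta_2x_2)^2\bigl(1+\tfrac{\nu^2}{2\alpha}\bigr)\Bigr]\right)\exp\left(-i\frac{\pi\nu^2\gamma}{4\alpha}x_1x_2\right),$$ where $F$ is entire on $\mathbb C$. The real part of the phase of the Gaussian function multiplying $F(x_1+i\beta_2x_2)$ is a negative definite quadratic form when $(\omega,\nu)\neq(0,0)$.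
   Context: Notation: $D_{x_j}=\frac1{2i\pi}\partial_{x_j}$, $\alpha=\sqrt{\nu^4+4\omega^2}$, $\mu_2=(1+\omega^2+\alpha)^{1/2}$, $\gamma=2\alpha/\omega$, $\beta_2=\frac{2\omega\mu_2}{\alpha+2\omega^2+\nu^2}$, $\lambda_1^2=\frac{\alpha-2\omega^2+\nu^2}{2\alpha}$, $\lambda_2^2=\frac{\alpha+2\omega^2+\nu^2}{2\alpha}$ ($\lambda_j>0$), $d=\frac{\gamma\lambda_1\lambda_2}2$, $c=\frac{\lambda_1^2+\lambda_2^2}{2\lambda_1\lambda_2}$. The kernel of $\mathcal L$ is taken in the sense of distributions. ("Phase" here means the exponent of the Gaussian factor.) *)

theory Defs
  imports "HOL-Complex_Analysis.Complex_Analysis" "HOL-Library.Function_Algebras"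
begin

text \<open>
  \<open>\<real>\<^sup>2\<close> is \<^typ>\<open>real \<times> real\<close>, with \<open>x\<^sub>1 = fst x\<close> and \<open>x\<^sub>2 = snd x\<close>.
\<close>

type_synonym plane_fun = "real \<times> real \<Rightarrow> complex"

definition pd1 :: "plane_fun \<Rightarrow> plane_fun" where
  "pd1 f = (\<lambda>x. frechet_derivative f (at x) (1, 0))"

definition pd2 :: "plane_fun \<Rightarrow> plane_fun" where
  "pd2 f = (\<lambda>x. frechet_derivative f (at x) (0, 1))"

primrec Ck :: "nat \<Rightarrow> plane_fun \<Rightarrow> bool" where
  "Ck 0 f \<longleftrightarrow> continuous_on UNIV f"
| "Ck (Suc k) f \<longleftrightarrow> (\<forall>x. f differentiable (at x)) \<and> Ck k (pd1 f) \<and> Ck k (pd2 f)"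

definition smooth :: "plane_fun \<Rightarrow> bool" where
  "smooth f \<longleftrightarrow> (\<forall>k. Ck k f)"

definition supp :: "plane_fun \<Rightarrow> (real \<times> real) set" where
  "supp f = closure {x. f x \<noteq> 0}"

definition test_fun :: "plane_fun \<Rightarrow> bool" where
  "test_fun \<phi> \<longleftrightarrow> smooth \<phi> \<and> compact (supp \<phi>)"

text \<open>
  A distribution is a linear functional on test functions satisfying, on every compact set
  \<open>K\<close>, an estimate \<open>|T \<phi>| \<le> C \<Sum>\<^bsub>i + j \<le> N\<^esub> sup |\<partial>\<^sub>1\<^sup>i \<partial>\<^sub>2\<^sup>j \<phi>|\<close>.  Only the values of \<open>T\<close> on test
  functions matter.
\<close>

type_synonym functional = "plane_fun \<Rightarrow> complex"

definition distribution :: "functional \<Rightarrow> bool" where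
  "distribution T \<longleftrightarrow>
     (\<forall>\<phi> \<psi>. test_fun \<phi> \<longrightarrow> test_fun \<psi> \<longrightarrow> T (\<lambda>x. \<phi> x + \<psi> x) = T \<phi> + T \<psi>) \<and>
     (\<forall>a \<phi>. test_fun \<phi> \<longrightarrow> T (\<lambda>x. a * \<phi> x) = a * T \<phi>) \<and>
     (\<forall>K. compact K \<longrightarrow>
        (\<exists>C N. \<forall>\<phi>. test_fun \<phi> \<longrightarrow> supp \<phi> \<subseteq> K \<longrightarrow>
           cmod (T \<phi>) \<le>
             C * (\<Sum>(i, j) \<in> {(i, j). i + j \<le> N}. SUP x. cmod ((pd1 ^^ i) ((pd2 ^^ j) \<phi>) x))))"

definition D1 :: "plane_fun \<Rightarrow> plane_fun" where
  "D1 f = (\<lambda>x. 1 / (2 * \<i> * of_real pi) * pd1 f x)"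

definition D2 :: "plane_fun \<Rightarrow> plane_fun" where
  "D2 f = (\<lambda>x. 1 / (2 * \<i> * of_real pi) * pd2 f x)"

text \<open>
  Extension by duality to distributions; the sign comes from integration by parts.
\<close>

definition dist_D1 :: "functional \<Rightarrow> functional" where
  "dist_D1 T = (\<lambda>\<phi>. - T (D1 \<phi>))"

definition dist_D2 :: "functional \<Rightarrow> functional" where
  "dist_D2 T = (\<lambda>\<phi>. - T (D2 \<phi>))"

definition dist_mult :: "plane_fun \<Rightarrow> functional \<Rightarrow> functional" where
  "dist_mult m T = (\<lambda>\<phi>. T (\<lambda>x. m x * \<phi> x))"

definition dist_of_fun :: "plane_fun \<Rightarrow> functional" where
  "dist_of_fun u = (\<lambda>\<phi>. \<integral>x. u x * \<phi> x \<partial>lebesgue)"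

definition opL :: "real \<Rightarrow> real \<Rightarrow> real \<Rightarrow> real \<Rightarrow> real \<Rightarrow> functional \<Rightarrow> functional" where
  "opL lam1 lam2 c d \<mu>2 T = (\<lambda>\<phi>.
       of_real (lam2 * c * d - d * inverse lam1) * dist_mult (\<lambda>x. of_real (fst x)) T \<phi>
     + of_real lam2 * dist_D2 T \<phi>
     - \<i> * of_real (\<mu>2 * lam1 * inverse d) * dist_D1 T \<phi>
     - \<i> * of_real (\<mu>2 * c * lam1) * dist_mult (\<lambda>x. of_real (snd x)) T \<phi>)"

definition dist_ker :: "(functional \<Rightarrow> functional) \<Rightarrow> functional set" where
  "dist_ker P = {T. distribution T \<and> (\<forall>\<phi>. test_fun \<phi> \<longrightarrow> P T \<phi> = 0)}"

text \<open>
  Elements of \<open>L\<^sup>2(\<real>\<^sup>2)\<close> are handled through their representatives: \<open>L2\<close> and \<open>LLL\<close> are sets of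
  functions, closed under modification on a Lebesgue null set.
\<close>

definition L2 :: "plane_fun set" where
  "L2 = {u. u \<in> borel_measurable lebesgue \<and> integrable lebesgue (\<lambda>x. (cmod (u x))\<^sup>2)}"

definition LLL :: "real \<Rightarrow> real \<Rightarrow> real \<Rightarrow> real \<Rightarrow> real \<Rightarrow> plane_fun set" where
  "LLL lam1 lam2 c d \<mu>2 = {u \<in> L2. dist_of_fun u \<in> dist_ker (opL lam1 lam2 c d \<mu>2)}"

definition neg_def_quadratic_form :: "(real \<times> real \<Rightarrow> real) \<Rightarrow> bool" where
  "neg_def_quadratic_form q \<longleftrightarrow>
     (\<exists>B. bilinear B \<and> (\<forall>x y. B x y = B y x) \<and> (\<forall>x. q x = B x x)) \<and>
     (\<forall>x. x \<noteq> 0 \<longrightarrow> q x < 0)"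

text \<open>The two exponents of the Gaussian factor; their sum is its phase.\<close>

definition phase1 :: "real \<Rightarrow> real \<Rightarrow> real \<Rightarrow> real \<Rightarrow> plane_fun" where
  "phase1 \<nu> \<alpha> \<beta>2 \<gamma> = (\<lambda>x. of_real (- (\<gamma> * pi / (4 * \<beta>2)) *
     ((fst x)\<^sup>2 * (1 - \<nu>\<^sup>2 / (2 * \<alpha>)) + (\<beta>2 * snd x)\<^sup>2 * (1 + \<nu>\<^sup>2 / (2 * \<alpha>)))))"

definition phase2 :: "real \<Rightarrow> real \<Rightarrow> real \<Rightarrow> plane_fun" where
  "phase2 \<nu> \<alpha> \<gamma> = (\<lambda>x. - \<i> * of_real (pi * \<nu>\<^sup>2 * \<gamma> / (4 * \<alpha>) * fst x * snd x))"

end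

theory Submission imports Defs begin

text \<open>
  Put \<open>b = \<beta>\<^sub>2\<close>, \<open>\<zeta> = x\<^sub>1 + i b x\<^sub>2\<close> and \<open>dbar f = \<partial>\<^sub>1 f + (i / b) \<partial>\<^sub>2 f\<close>, which is twice the
  Cauchy--Riemann derivative in the complex coordinate \<open>\<zeta>\<close>, and let \<open>\<Phi>\<close> be the phase.  The operator
  is \<open>\<L> u = - k e\<^sup>\<Phi> dbar (e\<^sup>-\<^sup>\<Phi> u)\<close> with \<open>k = \<lambda>\<^sub>2 b / (2 \<pi>)\<close>: the definitions of \<open>\<beta>\<^sub>2\<close>, \<open>c\<close> and \<open>d\<close> say exactly
  that the principal part of \<open>\<L>\<close> is a multiple of \<open>dbar\<close> and that its linear coefficient is a multiple of
  \<open>dbar \<Phi>\<close> (lemmas \<open>coefficient_identities\<close> and \<open>opL_transpose_conjugation\<close>).  Hence \<open>u\<close> lies in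
  the kernel iff \<open>v = e\<^sup>-\<^sup>\<Phi> u\<close> solves \<open>dbar v = 0\<close> weakly, and the theorem says that the weak solutions
  are the entire functions of \<open>\<zeta>\<close>.

  An entire function of \<open>\<zeta>\<close> is a weak solution by integration by parts, since the partial derivatives
  of a test function have integral zero.  The converse is Weyl's lemma (\<open>weyl_lemma\<close>) for locally
  integrable \<open>v\<close>.  Its proof rests on one identity: with \<open>q = |\<zeta>|\<^sup>2\<close>, a radial function satisfies
  \<open>dbar (cnj \<zeta> G(q)) = 2 (t G)'(q)\<close>.  If \<open>B\<close> is a bump supported in \<open>[1, 2]\<close> and \<open>B\<^sub>e(t) = B(t/e)/e\<close>, then
  \<open>B\<^sub>e - B = (t G)'\<close> for a smooth compactly supported \<open>G\<close>, so the difference of the mollifiers \<open>B\<^sub>e(q)\<close>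
  and \<open>B(q)\<close> is \<open>dbar\<close> of a test function.  Therefore the mollification of a weak solution does not
  depend on the scale \<open>e\<close>.  At a fixed scale it is differentiable, and its differential is complex
  linear because the antilinear part is again \<open>v\<close> tested against \<open>dbar\<close> of a test function.  As
  the scale tends to \<open>0\<close> its integral over any box tends to a constant multiple of that of \<open>v\<close>.  So \<open>v\<close>
  agrees almost everywhere with a function that is entire in \<open>\<zeta>\<close>.

  The quadratic form in the last claim is diagonal; its coefficients are negative because
  \<open>\<nu>\<^sup>2 \<le> \<alpha>\<close>.
\<close>

section \<open>Calculus of smooth functions on the plane\<close>

text \<open>
  The complex partial derivatives are carried along with the total derivative, so that the product and
  chain rules become identities between complex numbers.
\<close>

definition has_pds :: "plane_fun \<Rightarrow> complex \<Rightarrow> complex \<Rightarrow> real \<times> real \<Rightarrow> bool" where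
  "has_pds f a b x \<longleftrightarrow>
     (f has_derivative (\<lambda>h. of_real (fst h) * a + of_real (snd h) * b)) (at x)"

lemma has_pds_imp_pd1: "has_pds f a b x \<Longrightarrow> pd1 f x = a"
  unfolding has_pds_def pd1_def by (drule frechet_derivative_at) (metis (no_types, lifting)
      add.right_neutral fst_conv mult_1 mult_zero_left of_real_0 of_real_1 snd_conv)

lemma has_pds_imp_pd2: "has_pds f a b x \<Longrightarrow> pd2 f x = b"
  unfolding has_pds_def pd2_def by (drule frechet_derivative_at) (metis (no_types, lifting)
      add.left_neutral fst_conv mult_1 mult_zero_left of_real_0 of_real_1 snd_conv)

lemma has_pds_imp_differentiable: "has_pds f a b x \<Longrightarrow> f differentiable (at x)"
  unfolding has_pds_def differentiable_def by blast

lemma differentiable_imp_has_pds: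
  assumes "f differentiable (at x)"
  shows "has_pds f (pd1 f x) (pd2 f x) x"
proof -
  let ?D = "frechet_derivative f (at x)"
  have D: "(f has_derivative ?D) (at x)"
    using assms by (simp add: frechet_derivative_works)
  then interpret linear ?D by (rule has_derivative_linear)
  have "?D h = of_real (fst h) * pd1 f x + of_real (snd h) * pd2 f x" for h
  proof -
    have "h = fst h *\<^sub>R (1, 0) + snd h *\<^sub>R (0, 1)"
      by (simp add: prod_eq_iff)
    then have "?D h = fst h *\<^sub>R ?D (1, 0) + snd h *\<^sub>R ?D (0, 1)"
      by (metis add scale)
    then show ?thesis
      by (simp add: pd1_def pd2_def scaleR_conv_of_real)
  qed
  then have "?D = (\<lambda>h. of_real (fst h) * pd1 f x + of_real (snd h) * pd2 f x)"
    by blast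
  with D show ?thesis unfolding has_pds_def by simp
qed

lemma has_pds_const: "has_pds (\<lambda>x. c) 0 0 x"
  unfolding has_pds_def by simp

lemma has_pds_fst: "has_pds (\<lambda>x. of_real (fst x)) 1 0 x"
  unfolding has_pds_def by (auto intro!: derivative_eq_intros)

lemma has_pds_snd: "has_pds (\<lambda>x. of_real (snd x)) 0 1 x"
  unfolding has_pds_def by (auto intro!: derivative_eq_intros)

lemma has_pds_add:
  "has_pds f a b x \<Longrightarrow> has_pds g a' b' x \<Longrightarrow> has_pds (\<lambda>x. f x + g x) (a + a') (b + b') x"
  unfolding has_pds_def by (drule (1) has_derivative_add) (simp add: algebra_simps)

lemma has_pds_mult:
  "has_pds f a b x \<Longrightarrow> has_pds g a' b' x \<Longrightarrow>
    has_pds (\<lambda>x. f x * g x) (a * g x + f x * a') (b * g x + f x * b') x"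
  unfolding has_pds_def by (drule (1) has_derivative_mult) (simp add: algebra_simps)

lemma has_pds_compose:
  assumes "has_pds f a b x" "(g has_field_derivative g') (at (f x))"
  shows "has_pds (\<lambda>x. g (f x)) (g' * a) (g' * b) x"
  using has_derivative_compose[OF assms(1)[unfolded has_pds_def]
      assms(2)[unfolded has_field_derivative_def]]
  unfolding has_pds_def by (simp add: algebra_simps)

lemma CkI:
  assumes "\<And>x. has_pds f (a x) (b x) x" "Ck k a" "Ck k b"
  shows "Ck (Suc k) f"
proof -
  have "pd1 f = a" "pd2 f = b"
    using assms(1) has_pds_imp_pd1 has_pds_imp_pd2 by blast+
  then show ?thesis
    using assms has_pds_imp_differentiable unfolding Ck.simps by blast
qed

lemma Ck_Suc_imp_has_pds: "Ck (Suc k) f \<Longrightarrow> has_pds f (pd1 f x) (pd2 f x) x"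
  unfolding Ck.simps using differentiable_imp_has_pds by blast

lemma Ck_Suc_imp_Ck: "Ck (Suc k) f \<Longrightarrow> Ck k f"
proof (induction k arbitrary: f)
  case 0
  then show ?case
    using differentiable_imp_continuous_within
    unfolding Ck.simps continuous_on_eq_continuous_at[OF open_UNIV] by blast
next
  case (Suc k)
  have "Ck (Suc k) (pd1 f)" "Ck (Suc k) (pd2 f)" "\<forall>x. f differentiable at x"
    using Suc.prems unfolding Ck.simps(2)[of "Suc k"] by blast+
  then show ?case
    unfolding Ck.simps(2)[of k f] using Suc.IH by blast
qed

lemma Ck_const: "Ck k (\<lambda>x. c)"
proof (induction k arbitrary: c)
  case (Suc k)
  show ?case by (rule CkI[OF has_pds_const Suc Suc])
qed simp

lemma Ck_fst: "Ck k (\<lambda>x. of_real (fst x))"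
proof (cases k)
  case (Suc n)
  show ?thesis unfolding Suc by (rule CkI[OF has_pds_fst Ck_const Ck_const])
qed (simp add: continuous_on_fst continuous_on_snd continuous_on_of_real)

lemma Ck_snd: "Ck k (\<lambda>x. of_real (snd x))"
proof (cases k)
  case (Suc n)
  show ?thesis unfolding Suc by (rule CkI[OF has_pds_snd Ck_const Ck_const])
qed (simp add: continuous_on_fst continuous_on_snd continuous_on_of_real)

lemma Ck_add: "Ck k f \<Longrightarrow> Ck k g \<Longrightarrow> Ck k (\<lambda>x. f x + g x)"
proof (induction k arbitrary: f g)
  case 0
  then show ?case by (simp add: continuous_on_add)
next
  case (Suc k)
  have pds: "has_pds (\<lambda>x. f x + g x) (pd1 f x + pd1 g x) (pd2 f x + pd2 g x) x" for x
    by (rule has_pds_add) (rule Ck_Suc_imp_has_pds, fact)+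
  have *: "Ck k (pd1 f)" "Ck k (pd2 f)" "Ck k (pd1 g)" "Ck k (pd2 g)"
    using Suc.prems unfolding Ck.simps by blast+
  show ?case
    by (rule CkI[OF pds Suc.IH[OF *(1,3)] Suc.IH[OF *(2,4)]])
qed

lemma Ck_mult: "Ck k f \<Longrightarrow> Ck k g \<Longrightarrow> Ck k (\<lambda>x. f x * g x)"
proof (induction k arbitrary: f g)
  case 0
  then show ?case by (simp add: continuous_on_mult)
next
  case (Suc k)
  have pds: "has_pds (\<lambda>x. f x * g x) (pd1 f x * g x + f x * pd1 g x)
      (pd2 f x * g x + f x * pd2 g x) x" for x
    by (rule has_pds_mult) (rule Ck_Suc_imp_has_pds, fact)+
  have *: "Ck k (pd1 f)" "Ck k (pd2 f)" "Ck k (pd1 g)" "Ck k (pd2 g)"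
    using Suc.prems unfolding Ck.simps by blast+
  have fg: "Ck k f" "Ck k g"
    using Suc.prems Ck_Suc_imp_Ck by blast+
  show ?case
    by (rule CkI[OF pds Ck_add[OF Suc.IH[OF *(1) fg(2)] Suc.IH[OF fg(1) *(3)]]
          Ck_add[OF Suc.IH[OF *(2) fg(2)] Suc.IH[OF fg(1) *(4)]]])
qed

lemma Ck_holomorphic_compose:
  assumes "Ck k f" "g holomorphic_on UNIV"
  shows "Ck k (\<lambda>x. g (f x))"
  using assms
proof (induction k arbitrary: f g)
  case 0
  then show ?case
    using continuous_on_compose2[OF holomorphic_on_imp_continuous_on[OF 0(2)]] by simp
next
  case (Suc k)
  have pds: "has_pds (\<lambda>x. g (f x)) (deriv g (f x) * pd1 f x) (deriv g (f x) * pd2 f x) x" for x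
    by (rule has_pds_compose[OF Ck_Suc_imp_has_pds[OF Suc.prems(1)]])
       (use Suc.prems(2) holomorphic_derivI in blast)
  have "deriv g holomorphic_on UNIV"
    using Suc.prems(2) by (simp add: holomorphic_deriv)
  then have g': "Ck k (\<lambda>x. deriv g (f x))"
    by (rule Suc.IH[OF Ck_Suc_imp_Ck[OF Suc.prems(1)]])
  have *: "Ck k (pd1 f)" "Ck k (pd2 f)"
    using Suc.prems unfolding Ck.simps by blast+
  show ?case
    by (rule CkI[OF pds Ck_mult[OF g' *(1)] Ck_mult[OF g' *(2)]])
qed

lemma smooth_const: "smooth (\<lambda>x. c)"
  and smooth_fst: "smooth (\<lambda>x. of_real (fst x))"
  and smooth_snd: "smooth (\<lambda>x. of_real (snd x))"
  unfolding smooth_def using Ck_const Ck_fst Ck_snd by blast+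

lemma smooth_add: "smooth f \<Longrightarrow> smooth g \<Longrightarrow> smooth (\<lambda>x. f x + g x)"
  unfolding smooth_def using Ck_add by blast

lemma smooth_mult: "smooth f \<Longrightarrow> smooth g \<Longrightarrow> smooth (\<lambda>x. f x * g x)"
  unfolding smooth_def using Ck_mult by blast

lemma smooth_holomorphic_compose:
  "smooth f \<Longrightarrow> g holomorphic_on UNIV \<Longrightarrow> smooth (\<lambda>x. g (f x))"
  unfolding smooth_def using Ck_holomorphic_compose by blast

lemma smooth_imp_has_pds: "smooth f \<Longrightarrow> has_pds f (pd1 f x) (pd2 f x) x"
  unfolding smooth_def using Ck_Suc_imp_has_pds by blast

lemma smooth_pd1: "smooth f \<Longrightarrow> smooth (pd1 f)"
  and smooth_pd2: "smooth f \<Longrightarrow> smooth (pd2 f)"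
proof -
  assume f: "smooth f"
  have "Ck k (pd1 f) \<and> Ck k (pd2 f)" for k
    using f[unfolded smooth_def, THEN spec, of "Suc k"] unfolding Ck.simps by blast
  then show "smooth (pd1 f)" "smooth (pd2 f)"
    unfolding smooth_def by blast+
qed

lemma smooth_imp_continuous: "smooth f \<Longrightarrow> continuous_on S f"
proof -
  assume f: "smooth f"
  have "continuous_on UNIV f"
    using f[unfolded smooth_def, THEN spec, of 0] unfolding Ck.simps .
  then show ?thesis by (rule continuous_on_subset) blast
qed


section \<open>Test functions and locally integrable functions\<close>

lemma eq_0_outside_supp: "x \<notin> supp f \<Longrightarrow> f x = 0"
  unfolding supp_def using closure_subset[of "{x. f x \<noteq> 0}"] by blast

lemma supp_subsetI: "closed K \<Longrightarrow> (\<And>x. x \<notin> K \<Longrightarrow> f x = 0) \<Longrightarrow> supp f \<subseteq> K"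
  unfolding supp_def by (rule closure_minimal) auto

lemma test_funI:
  assumes "smooth f" "compact K" "\<And>x. x \<notin> K \<Longrightarrow> f x = 0"
  shows "test_fun f"
proof -
  have "supp f \<subseteq> K"
    using assms by (intro supp_subsetI compact_imp_closed)
  then have "compact (supp f)"
    using compact_Int_closed[OF assms(2), of "supp f"]
    by (simp add: supp_def inf.absorb2)
  with assms(1) show ?thesis by (simp add: test_fun_def)
qed

lemma test_fun_mult: "smooth g \<Longrightarrow> test_fun \<phi> \<Longrightarrow> test_fun (\<lambda>x. g x * \<phi> x)"
  by (rule test_funI[of _ "supp \<phi>"]) (auto simp: test_fun_def smooth_mult eq_0_outside_supp)

lemma has_pds_outside_supp:
  assumes "x \<notin> supp f"
  shows "has_pds f 0 0 x"
  unfolding has_pds_def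
proof (rule has_derivative_transform_within_open)
  show "((\<lambda>x. 0) has_derivative (\<lambda>h. of_real (fst h) * 0 + of_real (snd h) * 0)) (at x)"
    by simp
  show "open (- supp f)" by (simp add: supp_def open_Compl)
qed (use assms eq_0_outside_supp in auto)

lemma test_fun_pd1: "test_fun \<phi> \<Longrightarrow> test_fun (pd1 \<phi>)"
  and test_fun_pd2: "test_fun \<phi> \<Longrightarrow> test_fun (pd2 \<phi>)"
  by (rule test_funI[of _ "supp \<phi>"];
      simp add: test_fun_def smooth_pd1 smooth_pd2
        has_pds_imp_pd1[OF has_pds_outside_supp] has_pds_imp_pd2[OF has_pds_outside_supp])+

lemma test_fun_continuous: "test_fun \<phi> \<Longrightarrow> continuous_on S \<phi>"
  by (simp add: test_fun_def smooth_imp_continuous)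

definition locally_integrable :: "plane_fun \<Rightarrow> bool" where
  "locally_integrable v \<longleftrightarrow>
     v \<in> borel_measurable borel \<and> (\<forall>K. compact K \<longrightarrow> set_integrable lborel K v)"

lemma locally_integrable_continuous:
  "continuous_on UNIV v \<Longrightarrow> locally_integrable v"
  unfolding locally_integrable_def set_integrable_def
  by (auto intro!: borel_measurable_continuous_onI borel_integrable_compact
      intro: continuous_on_subset)

lemma locally_integrable_diff:
  "locally_integrable v \<Longrightarrow> locally_integrable w \<Longrightarrow> locally_integrable (\<lambda>x. v x - w x)"
  unfolding locally_integrable_def by (auto intro: set_integral_diff)

lemma compact_imp_sets_borel: "compact (K :: (real \<times> real) set) \<Longrightarrow> K \<in> sets borel"
  by (simp add: borel_compact)

text \<open>
  One estimate with three uses: pairing a locally integrable function with a test function, the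
  continuity estimate of a distribution, and the remainder term when a mollification is differentiated.
\<close>

lemma integrable_mult_bounded:
  assumes v: "locally_integrable v" and K: "compact K"
    and g: "g \<in> borel_measurable borel" "\<And>x. x \<in> K \<Longrightarrow> cmod (g x) \<le> C"
    and 0: "\<And>x. x \<notin> K \<Longrightarrow> g x = 0"
  shows "integrable lborel (\<lambda>x. v x * g x)"
    and "cmod (\<integral>x. v x * g x \<partial>lborel) \<le> C * (\<integral>x\<in>K. cmod (v x) \<partial>lborel)"
proof -
  have vK: "set_integrable lborel K v" and [measurable]: "v \<in> borel_measurable borel"
    using v K by (auto simp: locally_integrable_def)
  note [measurable] = g(1)
  have iv: "integrable lborel (\<lambda>x. C * (indicator K x *\<^sub>R cmod (v x)))"
    using set_integrable_norm[OF vK] unfolding set_integrable_def by simp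
  have bd: "cmod (v x * g x) \<le> C * (indicator K x *\<^sub>R cmod (v x))" for x
  proof (cases "x \<in> K")
    case True
    then show ?thesis
      using mult_left_mono[OF g(2)[OF True], of "cmod (v x)"]
      by (simp add: norm_mult mult.commute)
  qed (simp add: 0)
  show int: "integrable lborel (\<lambda>x. v x * g x)"
    by (rule Bochner_Integration.integrable_bound[OF iv])
       (use bd in \<open>auto intro!: AE_I2 order_trans[OF bd]\<close>)
  have "cmod (\<integral>x. v x * g x \<partial>lborel) \<le> (\<integral>x. C * (indicator K x *\<^sub>R cmod (v x)) \<partial>lborel)"
    by (rule order_trans[OF integral_norm_bound])
       (rule integral_mono[OF integrable_norm[OF int] iv bd])
  then show "cmod (\<integral>x. v x * g x \<partial>lborel) \<le> C * (\<integral>x\<in>K. cmod (v x) \<partial>lborel)"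
    unfolding set_lebesgue_integral_def by simp
qed

lemma compact_continuous_bound:
  fixes g :: plane_fun
  assumes "compact K" "continuous_on UNIV g"
  obtains C where "\<And>x. x \<in> K \<Longrightarrow> cmod (g x) \<le> C"
proof -
  have "compact (g ` K)"
    using assms by (meson compact_continuous_image continuous_on_subset subset_UNIV)
  then show ?thesis
    using that compact_imp_bounded[of "g ` K"] by (auto simp: bounded_iff)
qed

lemma integrable_mult_continuous:
  assumes "locally_integrable v" "compact K" "continuous_on UNIV g" "\<And>x. x \<notin> K \<Longrightarrow> g x = 0"
  shows "integrable lborel (\<lambda>x. v x * g x)"
proof -
  obtain C where C: "\<And>x. x \<in> K \<Longrightarrow> cmod (g x) \<le> C"
    using compact_continuous_bound[OF assms(2,3)] by blast
  show ?thesis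
    by (rule integrable_mult_bounded(1)[OF assms(1,2) _ C assms(4)])
       (simp_all add: assms(3) borel_measurable_continuous_onI)
qed

lemma integrable_mult_test_fun:
  assumes "locally_integrable v" "test_fun \<phi>"
  shows "integrable lborel (\<lambda>x. v x * \<phi> x)"
  by (rule integrable_mult_continuous[OF assms(1), of "supp \<phi>"])
     (use assms in \<open>auto simp: test_fun_def smooth_imp_continuous eq_0_outside_supp\<close>)

lemma integrable_test_fun: "test_fun \<phi> \<Longrightarrow> integrable lborel \<phi>"
  using integrable_mult_test_fun[OF locally_integrable_continuous[of "\<lambda>x. 1"]] by simp

text \<open>
  The line integrals to which Fubini's theorem reduces the integral of a partial derivative of a test
  function.
\<close>

lemma integral_derivative_eq_0:
  fixes f :: "real \<Rightarrow> complex"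
  assumes f: "\<And>t. (f has_vector_derivative f' t) (at t)" "continuous_on UNIV f'"
    and R: "R \<ge> 0" "\<And>t. \<bar>t\<bar> \<ge> R \<Longrightarrow> f t = 0" "\<And>t. \<bar>t\<bar> > R \<Longrightarrow> f' t = 0"
  shows "(\<integral>t. f' t \<partial>lborel) = 0"
proof -
  have "(\<integral>t. f' t \<partial>lborel) = (\<integral>t. indicator {-R..R} t *\<^sub>R f' t \<partial>lborel)"
    by (rule Bochner_Integration.integral_cong) (use R(3) in \<open>auto simp: indicator_def abs_if split: if_splits\<close>)
  also have "\<dots> = f R - f (-R)"
    by (rule integral_FTC_Icc)
       (use R f in \<open>auto intro: has_vector_derivative_at_within continuous_on_subset\<close>)
  also have "\<dots> = 0" using R by simp
  finally show ?thesis .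
qed

lemma test_fun_bounded_support:
  assumes "test_fun \<phi>"
  obtains R where "R \<ge> 0" "\<And>x. \<bar>fst x\<bar> \<ge> R \<or> \<bar>snd x\<bar> \<ge> R \<Longrightarrow> x \<notin> supp \<phi>"
proof -
  have "bounded (supp \<phi>)"
    using assms by (simp add: test_fun_def compact_imp_bounded)
  then obtain r where r: "\<And>x. x \<in> supp \<phi> \<Longrightarrow> norm x \<le> r"
    by (auto simp: bounded_iff)
  have "\<bar>fst x\<bar> \<le> norm x" "\<bar>snd x\<bar> \<le> norm x" for x :: "real \<times> real"
    using dist_fst_le[of x 0] dist_snd_le[of x 0] by (simp_all add: dist_norm)
  then have "\<bar>fst x\<bar> < max 0 r + 1 \<and> \<bar>snd x\<bar> < max 0 r + 1" if "x \<in> supp \<phi>" for x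
    using r[OF that] by (meson le_less_trans less_add_one max.cobounded2 order_trans)
  then show ?thesis by (intro that[of "max 0 r + 1"]) (auto simp: not_less[symmetric])
qed

lemma integral_pd1_eq_0:
  assumes "test_fun \<psi>"
  shows "(\<integral>x. pd1 \<psi> x \<partial>lborel) = 0"
proof -
  obtain R where R: "R \<ge> 0" "\<And>x. \<bar>fst x\<bar> \<ge> R \<or> \<bar>snd x\<bar> \<ge> R \<Longrightarrow> x \<notin> supp \<psi>"
    using test_fun_bounded_support[OF assms] by metis
  have inner: "(\<integral>s. pd1 \<psi> (s, t) \<partial>lborel) = 0" for t
  proof (rule integral_derivative_eq_0[where f = "\<lambda>s. \<psi> (s, t)", OF _ _ R(1)])
    fix s
    have D: "(\<psi> has_derivative (\<lambda>h. of_real (fst h) * pd1 \<psi> (s, t) + of_real (snd h) * pd2 \<psi> (s, t)))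
        (at (s, t))"
      using assms smooth_imp_has_pds unfolding test_fun_def has_pds_def by blast
    have E: "((\<lambda>s. (s, t)) has_derivative (\<lambda>h. (h, 0))) (at s)"
      by (auto intro!: derivative_eq_intros)
    show "((\<lambda>s. \<psi> (s, t)) has_vector_derivative pd1 \<psi> (s, t)) (at s)"
      using has_derivative_compose[OF E D]
      unfolding has_vector_derivative_def by (simp add: scaleR_conv_of_real)
  next
    show "continuous_on UNIV (\<lambda>s. pd1 \<psi> (s, t))"
      using continuous_on_compose2[OF test_fun_continuous[OF test_fun_pd1[OF assms], of UNIV],
          of UNIV "\<lambda>s. (s, t)"] by (simp add: continuous_intros)
  qed (use R(2) in \<open>auto simp: eq_0_outside_supp has_pds_imp_pd1[OF has_pds_outside_supp]\<close>)
  have "integrable (lborel \<Otimes>\<^sub>M lborel) (\<lambda>(s, t). pd1 \<psi> (s, t))"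
    using integrable_test_fun[OF test_fun_pd1[OF assms]] by (simp add: lborel_prod)
  from lborel_pair.integral_snd[OF this] inner show ?thesis
    by (simp add: lborel_prod)
qed

lemma integral_pd2_eq_0:
  assumes "test_fun \<psi>"
  shows "(\<integral>x. pd2 \<psi> x \<partial>lborel) = 0"
proof -
  obtain R where R: "R \<ge> 0" "\<And>x. \<bar>fst x\<bar> \<ge> R \<or> \<bar>snd x\<bar> \<ge> R \<Longrightarrow> x \<notin> supp \<psi>"
    using test_fun_bounded_support[OF assms] by metis
  have inner: "(\<integral>t. pd2 \<psi> (s, t) \<partial>lborel) = 0" for s
  proof (rule integral_derivative_eq_0[where f = "\<lambda>t. \<psi> (s, t)", OF _ _ R(1)])
    fix t
    have D: "(\<psi> has_derivative (\<lambda>h. of_real (fst h) * pd1 \<psi> (s, t) + of_real (snd h) * pd2 \<psi> (s, t)))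
        (at (s, t))"
      using assms smooth_imp_has_pds unfolding test_fun_def has_pds_def by blast
    have E: "((\<lambda>t. (s, t)) has_derivative (\<lambda>h. (0, h))) (at t)"
      by (auto intro!: derivative_eq_intros)
    show "((\<lambda>t. \<psi> (s, t)) has_vector_derivative pd2 \<psi> (s, t)) (at t)"
      using has_derivative_compose[OF E D]
      unfolding has_vector_derivative_def by (simp add: scaleR_conv_of_real)
  next
    show "continuous_on UNIV (\<lambda>t. pd2 \<psi> (s, t))"
      using continuous_on_compose2[OF test_fun_continuous[OF test_fun_pd2[OF assms], of UNIV],
          of UNIV "\<lambda>t. (s, t)"] by (simp add: continuous_intros)
  qed (use R(2) in \<open>auto simp: eq_0_outside_supp has_pds_imp_pd2[OF has_pds_outside_supp]\<close>)
  have "integrable (lborel \<Otimes>\<^sub>M lborel) (\<lambda>(s, t). pd2 \<psi> (s, t))"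
    using integrable_test_fun[OF test_fun_pd2[OF assms]] by (simp add: lborel_prod)
  from lborel_pair.integral_fst[OF this] inner show ?thesis
    by (simp add: lborel_prod)
qed


section \<open>A smooth bump function on the line\<close>

text \<open>
  Differentiability of order \<open>k\<close> with an arbitrary witness for the derivative: it depends only on the
  values of \<open>f\<close> on an open set \<open>S\<close>, which makes it local and lets it be glued over open covers.
\<close>

fun ck :: "nat \<Rightarrow> real set \<Rightarrow> (real \<Rightarrow> real) \<Rightarrow> bool" where
  "ck 0 S f \<longleftrightarrow> continuous_on S f"
| "ck (Suc k) S f \<longleftrightarrow> (\<exists>f'. (\<forall>t\<in>S. (f has_real_derivative f' t) (at t)) \<and> ck k S f')"

lemma DERIV_imp_continuous_on:
  fixes f :: "real \<Rightarrow> real"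
  assumes "\<And>t. t \<in> S \<Longrightarrow> (f has_real_derivative f' t) (at t)"
  shows "continuous_on S f"
  by (rule DERIV_continuous_on[OF has_field_derivative_at_within[OF assms]])

lemma ckI:
  "(\<And>t. t \<in> S \<Longrightarrow> (f has_real_derivative f' t) (at t)) \<Longrightarrow> ck k S f' \<Longrightarrow> ck (Suc k) S f"
  by auto

lemma ck_cong: "ck k S f \<Longrightarrow> open S \<Longrightarrow> (\<And>t. t \<in> S \<Longrightarrow> f t = g t) \<Longrightarrow> ck k S g"
proof (induction k arbitrary: f g)
  case 0
  then show ?case using continuous_on_cong[of S S f g] by simp
next
  case (Suc k)
  then obtain f' where f': "\<And>t. t \<in> S \<Longrightarrow> (f has_real_derivative f' t) (at t)" "ck k S f'"
    unfolding ck.simps by blast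
  have "(g has_real_derivative f' t) (at t)" if "t \<in> S" for t
    by (rule has_field_derivative_transform_within_open[OF f'(1)[OF that] Suc.prems(2) that])
       (rule Suc.prems(3))
  with f'(2) show ?case by auto
qed

lemma ck_Suc_imp_ck: "ck (Suc k) S f \<Longrightarrow> ck k S f"
proof (induction k arbitrary: f)
  case 0
  then obtain f' where "\<And>t. t \<in> S \<Longrightarrow> (f has_real_derivative f' t) (at t)"
    unfolding ck.simps by blast
  then show ?case
    unfolding ck.simps by (rule DERIV_imp_continuous_on)
next
  case (Suc k)
  then obtain f' where "\<forall>t\<in>S. (f has_real_derivative f' t) (at t)" "ck (Suc k) S f'"
    unfolding ck.simps(2)[of "Suc k"] by blast
  with Suc.IH show ?case unfolding ck.simps(2)[of k] by blast
qed

lemma ck_mono: "ck k S f \<Longrightarrow> T \<subseteq> S \<Longrightarrow> ck k T f"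
proof (induction k arbitrary: f)
  case 0
  then show ?case using continuous_on_subset by simp
next
  case (Suc k)
  then show ?case unfolding ck.simps by blast
qed

lemma ck_Un:
  assumes "open S" "open T"
  shows "ck k S f \<Longrightarrow> ck k T f \<Longrightarrow> ck k (S \<union> T) f"
proof (induction k arbitrary: f)
  case 0
  then show ?case using assms by (simp add: continuous_on_open_Un)
next
  case (Suc k)
  obtain p where p: "\<And>t. t \<in> S \<Longrightarrow> (f has_real_derivative p t) (at t)" "ck k S p"
    using Suc.prems by auto
  obtain q where q: "\<And>t. t \<in> T \<Longrightarrow> (f has_real_derivative q t) (at t)" "ck k T q"
    using Suc.prems by auto
  have "p t = deriv f t" if "t \<in> S" for t
    using p(1)[OF that] by (simp add: DERIV_imp_deriv)
  moreover have "q t = deriv f t" if "t \<in> T" for t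
    using q(1)[OF that] by (simp add: DERIV_imp_deriv)
  ultimately have "ck k S (deriv f)" "ck k T (deriv f)"
    using ck_cong[OF p(2) assms(1)] ck_cong[OF q(2) assms(2)] by blast+
  then have "ck k (S \<union> T) (deriv f)" by (rule Suc.IH)
  moreover have "(f has_real_derivative deriv f t) (at t)" if "t \<in> S \<union> T" for t
    using that p(1) q(1) by (metis DERIV_imp_deriv UnE)
  ultimately show ?case by auto
qed

lemma ck_Suc_imp_DERIV: "ck (Suc k) UNIV f \<Longrightarrow> (f has_real_derivative deriv f t) (at t)"
  unfolding ck.simps by (metis DERIV_imp_deriv UNIV_I)

lemma ck_Suc_imp_ck_deriv: "ck (Suc k) UNIV f \<Longrightarrow> ck k UNIV (deriv f)"
proof -
  assume "ck (Suc k) UNIV f"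
  then obtain f' where f': "\<And>t. (f has_real_derivative f' t) (at t)" "ck k UNIV f'"
    unfolding ck.simps by blast
  have "deriv f = f'" using DERIV_imp_deriv[OF f'(1)] by blast
  with f' show ?thesis by simp
qed

lemma ck_const: "ck k S (\<lambda>t. c)"
proof (induction k arbitrary: c)
  case (Suc k)
  show ?case unfolding ck.simps by (rule exI[of _ "\<lambda>t. 0"]) (use Suc in auto)
qed simp

lemma ck_ident: "ck k S (\<lambda>t. t)"
proof (cases k)
  case (Suc n)
  show ?thesis unfolding Suc ck.simps by (rule exI[of _ "\<lambda>t. 1"]) (use ck_const in auto)
qed simp

lemma ck_add: "ck k S f \<Longrightarrow> ck k S g \<Longrightarrow> ck k S (\<lambda>t. f t + g t)"
proof (induction k arbitrary: f g)
  case 0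
  then show ?case by (simp add: continuous_on_add)
next
  case (Suc k)
  then obtain f' g' where *: "ck k S f'" "ck k S g'"
    "\<And>t. t \<in> S \<Longrightarrow> (f has_real_derivative f' t) (at t)"
    "\<And>t. t \<in> S \<Longrightarrow> (g has_real_derivative g' t) (at t)" by auto
  show ?case unfolding ck.simps
    by (rule exI[of _ "\<lambda>t. f' t + g' t"]) (use * Suc.IH in \<open>auto intro: DERIV_add\<close>)
qed

lemma ck_mult: "ck k S f \<Longrightarrow> ck k S g \<Longrightarrow> ck k S (\<lambda>t. f t * g t)"
proof (induction k arbitrary: f g)
  case 0
  then show ?case by (simp add: continuous_on_mult)
next
  case (Suc k)
  then obtain f' g' where *: "ck k S f'" "ck k S g'"
    "\<And>t. t \<in> S \<Longrightarrow> (f has_real_derivative f' t) (at t)"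
    "\<And>t. t \<in> S \<Longrightarrow> (g has_real_derivative g' t) (at t)" by auto
  have "ck k S f" "ck k S g" using Suc.prems ck_Suc_imp_ck by blast+
  then have "ck k S (\<lambda>t. f' t * g t + g' t * f t)"
    using * by (intro ck_add Suc.IH)
  then show ?case
    by (rule ckI[rotated]) (rule DERIV_mult[OF *(3) *(4)])
qed

lemma ck_inverse: "ck k S f \<Longrightarrow> (\<And>t. t \<in> S \<Longrightarrow> f t \<noteq> 0) \<Longrightarrow> ck k S (\<lambda>t. inverse (f t))"
proof (induction k)
  case 0
  then show ?case by (simp add: continuous_on_inverse)
next
  case (Suc k)
  then obtain f' where *: "ck k S f'"
    "\<And>t. t \<in> S \<Longrightarrow> (f has_real_derivative f' t) (at t)" by auto
  have "ck k S (\<lambda>t. inverse (f t))" using Suc ck_Suc_imp_ck by blast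
  then have "ck k S (\<lambda>t. (-1) * (f' t * (inverse (f t) * inverse (f t))))"
    using * by (intro ck_mult ck_const)
  then show ?case
    by (rule ckI[rotated])
       (use DERIV_inverse_fun[OF *(2) Suc.prems(2)] in \<open>simp add: algebra_simps\<close>)
qed

lemma ck_affine: "ck k UNIV f \<Longrightarrow> ck k UNIV (\<lambda>t. f (a * t + c))"
proof (induction k arbitrary: f)
  case 0
  then show ?case
    using continuous_on_compose2[of UNIV f UNIV "\<lambda>t. a * t + c"] by (simp add: continuous_intros)
next
  case (Suc k)
  then obtain f' where *: "ck k UNIV f'" "\<And>t. (f has_real_derivative f' t) (at t)" by auto
  have "ck k UNIV (\<lambda>t. f' (a * t + c) * a)"
    using * by (intro ck_mult ck_const Suc.IH)
  then show ?case
    by (rule ckI[rotated]) (rule DERIV_chain2[OF *(2)], auto intro!: derivative_eq_intros)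
qed

text \<open>
  Differentiating \<open>flat n\<close> gives a combination of \<open>flat (n + 2)\<close> and \<open>flat (n + 1)\<close>, so the whole family
  is smooth by induction as soon as each member is differentiable at \<open>0\<close>.
\<close>

definition flat :: "nat \<Rightarrow> real \<Rightarrow> real" where
  "flat n t = (if t > 0 then exp (- inverse t) * inverse t ^ n else 0)"

lemma flat_tendsto_0: "(flat n \<longlongrightarrow> 0) (at 0)"
proof -
  have "((\<lambda>x::real. x ^ n / exp x) \<longlongrightarrow> 0) at_top"
    by (rule tendsto_power_div_exp_0)
  then have "((\<lambda>t::real. inverse t ^ n / exp (inverse t)) \<longlongrightarrow> 0) (at_right 0)"
    by (rule filterlim_compose) (rule filterlim_inverse_at_top_right)
  then have "(flat n \<longlongrightarrow> 0) (at_right 0)"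
  proof (rule Lim_transform_eventually)
    show "\<forall>\<^sub>F t in at_right 0. inverse t ^ n / exp (inverse t) = flat n t"
      using eventually_at_right_less[of "0::real"]
      by eventually_elim (simp add: flat_def exp_minus field_simps)
  qed
  moreover have "(flat n \<longlongrightarrow> 0) (at_left 0)"
  proof (rule Lim_transform_eventually[OF tendsto_const])
    show "\<forall>\<^sub>F t in at_left 0. 0 = flat n t"
      unfolding eventually_at_filter by (simp add: flat_def)
  qed
  ultimately show ?thesis by (simp add: filterlim_split_at)
qed

lemma DERIV_flat:
  "(flat n has_real_derivative flat (n + 2) t - real n * flat (n + 1) t) (at t)"
proof -
  consider "t > 0" | "t < 0" | "t = 0" by linarith
  then show ?thesis
  proof cases
    case 1
    have "((\<lambda>t. exp (- inverse t) * inverse t ^ n) has_real_derivative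
        flat (n + 2) t - real n * flat (n + 1) t) (at t)"
    proof (cases n)
      case 0
      with 1 show ?thesis
        by (auto intro!: derivative_eq_intros simp: flat_def power2_eq_square)
    next
      case (Suc m)
      with 1 show ?thesis
        by (auto intro!: derivative_eq_intros simp: flat_def power2_eq_square algebra_simps)
          (cases m; simp)
    qed
    then show ?thesis
      by (rule has_field_derivative_transform_within_open[of _ _ _ "{0<..}"])
         (use 1 in \<open>auto simp: flat_def\<close>)
  next
    case 2
    have "((\<lambda>t. 0) has_real_derivative flat (n + 2) t - real n * flat (n + 1) t) (at t)"
      using 2 by (simp add: flat_def)
    then show ?thesis
      by (rule has_field_derivative_transform_within_open[of _ _ _ "{..<0}"])
         (use 2 in \<open>auto simp: flat_def\<close>)
  next
    case 3
    have "((\<lambda>h. (flat n (0 + h) - flat n 0) / h) \<longlongrightarrow> 0) (at 0)"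
    proof (rule Lim_transform_eventually[OF flat_tendsto_0[of "Suc n"]])
      show "\<forall>\<^sub>F h in at 0. flat (Suc n) h = (flat n (0 + h) - flat n 0) / h"
        by (intro always_eventually allI) (auto simp: flat_def field_simps)
    qed
    then have "(flat n has_real_derivative 0) (at 0)"
      by (simp add: DERIV_def)
    with 3 show ?thesis by (simp add: flat_def)
  qed
qed

lemma ck_flat: "ck k UNIV (flat n)"
proof (induction k arbitrary: n)
  case 0
  show ?case unfolding ck.simps by (rule DERIV_imp_continuous_on[OF DERIV_flat])
next
  case (Suc k)
  have "ck k UNIV (\<lambda>t. flat (n + 2) t + (- real n) * flat (n + 1) t)"
    by (rule ck_add[OF Suc ck_mult[OF ck_const Suc]])
  then show ?case using DERIV_flat[of n] by (intro ckI[of _ _ "\<lambda>t. flat (n + 2) t - real n * flat (n + 1) t"]) simp_all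
qed

definition bump :: "real \<Rightarrow> real" where
  "bump t = flat 0 (t - 1) * flat 0 (2 - t)"

lemma bump_nonneg: "bump t \<ge> 0"
  and bump_pos: "1 < t \<Longrightarrow> t < 2 \<Longrightarrow> bump t > 0"
  and bump_eq_0: "t \<le> 1 \<or> t \<ge> 2 \<Longrightarrow> bump t = 0"
  by (auto simp: bump_def flat_def)

lemma ck_bump: "ck k UNIV bump"
proof -
  have "ck k UNIV (\<lambda>t. flat 0 (1 * t + (-1)) * flat 0 ((-1) * t + 2))"
    by (rule ck_mult[OF ck_affine[OF ck_flat] ck_affine[OF ck_flat]])
  then show ?thesis by (simp add: bump_def[abs_def])
qed

lemma continuous_bump: "continuous_on S bump"
  using ck_bump[of 0] by (auto intro: continuous_on_subset)

definition bump_int :: "real \<Rightarrow> real" where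
  "bump_int t = integral {1..t} bump"

lemma bump_int_eq_0: "t \<le> 1 \<Longrightarrow> bump_int t = 0"
  unfolding bump_int_def by (cases "t = 1") auto

lemma DERIV_bump_int: "(bump_int has_real_derivative bump t) (at t)"
proof (cases "t < 1")
  case True
  have "((\<lambda>t. 0) has_real_derivative bump t) (at t)"
    using True by (simp add: bump_eq_0)
  then show ?thesis
    by (rule has_field_derivative_transform_within_open[of _ _ _ "{..<1}"])
       (use True in \<open>auto simp: bump_int_eq_0\<close>)
next
  case False
  \<comment> \<open>starting at 0 instead of 1 leaves the integral unchanged and makes \<open>t = 1\<close> an inner point\<close>
  let ?I = "\<lambda>t. integral {0..t} bump"
  have "(?I has_real_derivative bump t) (at t within {0..t + 1})"
    by (rule integral_has_real_derivative) (use False in \<open>auto simp: continuous_bump\<close>)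
  then have "(?I has_real_derivative bump t) (at t)"
    using False by (subst (asm) at_within_interior) (auto simp: interior_cbox[of 0 "t+1", simplified box_real])
  moreover have "?I s = bump_int s" if "s \<in> {0<..}" for s
  proof (cases "s \<le> 1")
    case True
    have "?I s = integral {0..s} (\<lambda>t. 0)"
      by (rule Henstock_Kurzweil_Integration.integral_cong) (use True in \<open>auto simp: bump_eq_0\<close>)
    with True show ?thesis by (simp add: bump_int_eq_0)
  next
    case False
    have "?I s = integral {0..1} bump + integral {1..s} bump"
      using False by (intro Henstock_Kurzweil_Integration.integral_combine[symmetric])
        (auto intro!: integrable_continuous_interval continuous_bump)
    moreover have "integral {0..1} bump = integral {0..1} (\<lambda>t::real. 0)"
      by (intro Henstock_Kurzweil_Integration.integral_cong) (auto simp: bump_eq_0)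
    ultimately show ?thesis by (simp add: bump_int_def)
  qed
  ultimately show ?thesis
    by (elim has_field_derivative_transform_within_open[of _ _ _ "{0<..}"]) (use False in auto)
qed

lemma bump_int_const: "t \<ge> 2 \<Longrightarrow> bump_int t = bump_int 2"
proof -
  assume "t \<ge> 2"
  have "(bump has_integral (bump_int t - bump_int 2)) {2..t}"
    by (rule fundamental_theorem_of_calculus[OF \<open>t \<ge> 2\<close>])
       (use DERIV_bump_int in \<open>auto simp: has_real_derivative_iff_has_vector_derivative
           intro: has_vector_derivative_at_within\<close>)
  moreover have "(bump has_integral 0) {2..t}"
    by (rule has_integral_is_0) (auto simp: bump_eq_0)
  ultimately have "bump_int t - bump_int 2 = 0" by (rule has_integral_unique)
  then show ?thesis by simp
qed

lemma ck_bump_int: "ck k UNIV bump_int"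
proof (cases k)
  case 0
  then show ?thesis using DERIV_imp_continuous_on[OF DERIV_bump_int] by simp
next
  case (Suc n)
  show ?thesis unfolding Suc by (rule ckI[OF DERIV_bump_int ck_bump])
qed

text \<open>
  The functions \<open>bump (t / e) / e\<close> and \<open>bump t\<close> have the same total integral, so the primitive of their
  difference vanishes for large \<open>t\<close> as well as near \<open>0\<close>.  The latter allows the division by \<open>t\<close>:
  the difference is \<open>(t G)'\<close> with \<open>G = bump_quot e\<close> smooth and compactly supported.
\<close>

definition bump_quot :: "real \<Rightarrow> real \<Rightarrow> real" where
  "bump_quot e t = (bump_int (t / e) - bump_int t) * inverse t"

lemma bump_quot_eq_0:
  assumes "e > 0" shows "t \<le> min 1 e \<or> t \<ge> max 2 (2 * e) \<Longrightarrow> bump_quot e t = 0"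
  unfolding bump_quot_def using assms
    bump_int_eq_0[of t] bump_int_eq_0[of "t / e"] bump_int_const[of t] bump_int_const[of "t / e"]
  by (auto simp: field_simps)

lemma ck_bump_quot:
  assumes e: "e > 0"
  shows "ck k UNIV (bump_quot e)"
proof -
  have "ck k UNIV (\<lambda>t. bump_int (inverse e * t + 0) + (-1) * bump_int (1 * t + 0))"
    by (rule ck_add[OF ck_affine[OF ck_bump_int] ck_mult[OF ck_const ck_affine[OF ck_bump_int]]])
  from ck_mult[OF ck_mono[OF this subset_UNIV] ck_inverse[OF ck_ident, of "- {0}"]]
  have 1: "ck k (- {0}) (bump_quot e)"
    by (simp add: bump_quot_def[abs_def] divide_inverse mult.commute)
  have 2: "ck k {..<min 1 e} (bump_quot e)"
    by (rule ck_cong[OF ck_const[of k _ 0]]) (use e bump_quot_eq_0 in auto)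
  have "- {0} \<union> {..<min 1 e} = UNIV" using e by auto
  with ck_Un[OF _ _ 1 2] show ?thesis by (simp add: open_Compl)
qed

lemma DERIV_bump_quot:
  assumes e: "e > 0"
  obtains g where "\<And>t. (bump_quot e has_real_derivative g t) (at t)"
    "\<And>k. ck k UNIV g" "\<And>t. bump_quot e t + t * g t = bump (t / e) / e - bump t"
proof -
  define g where "g = deriv (bump_quot e)"
  have D: "(bump_quot e has_real_derivative g t) (at t)" for t
    unfolding g_def by (rule ck_Suc_imp_DERIV[OF ck_bump_quot[OF e]])
  moreover have "ck k UNIV g" for k
    unfolding g_def by (rule ck_Suc_imp_ck_deriv[OF ck_bump_quot[OF e]])
  moreover have "bump_quot e t + t * g t = bump (t / e) / e - bump t" for t
  proof -
    have eq: "t * bump_quot e t = bump_int (t / e) - bump_int t" for t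
      using e by (cases "t = 0") (auto simp: bump_quot_def bump_int_eq_0)
    have "((\<lambda>t. t * bump_quot e t) has_real_derivative bump_quot e t + t * g t) (at t)"
      by (auto intro!: derivative_eq_intros D)
    moreover have "((\<lambda>t. bump_int (t / e)) has_real_derivative bump (t / e) * (1 / e)) (at t)"
      by (rule DERIV_chain2[OF DERIV_bump_int]) (use e in \<open>auto intro!: derivative_eq_intros\<close>)
    then have "((\<lambda>t. t * bump_quot e t) has_real_derivative bump (t / e) / e - bump t) (at t)"
      unfolding eq using DERIV_diff[OF _ DERIV_bump_int] by simp
    ultimately show ?thesis by (rule DERIV_unique)
  qed
  ultimately show ?thesis using that by blast
qed

lemma vanishing_outside_Icc_bounded:
  fixes f :: "real \<Rightarrow> real"
  assumes "continuous_on UNIV f" "\<And>t. t < a \<or> t > c \<Longrightarrow> f t = 0"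
  obtains C where "C \<ge> 0" "\<And>t. \<bar>f t\<bar> \<le> C"
proof -
  have "compact (f ` {a..c})"
    using assms(1) by (meson compact_Icc compact_continuous_image continuous_on_subset subset_UNIV)
  then obtain C where "\<And>t. t \<in> {a..c} \<Longrightarrow> \<bar>f t\<bar> \<le> C"
    using compact_imp_bounded[of "f ` {a..c}"] unfolding bounded_iff by (metis imageI real_norm_def)
  then have "\<bar>f t\<bar> \<le> max 0 C" for t
    using assms(2)[of t] by (cases "t \<in> {a..c}") (auto simp: max.coboundedI2)
  then show ?thesis by (intro that[of "max 0 C"]) auto
qed

text \<open>
  The bound is uniform in \<open>t\<close>, which is what allows differentiation under the integral sign against a
  function that is merely locally integrable.
\<close>

lemma bump_taylor:
  obtains g C where "\<And>t. (bump has_real_derivative g t) (at t)" "\<And>k. ck k UNIV g"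
    "\<And>t. t < 1 \<or> t > 2 \<Longrightarrow> g t = 0"
    "\<And>t s. \<bar>bump (t + s) - bump t - g t * s\<bar> \<le> C * s\<^sup>2"
proof -
  define g where "g = deriv bump"
  have D: "(bump has_real_derivative g t) (at t)" for t
    unfolding g_def by (rule ck_Suc_imp_DERIV[OF ck_bump])
  have ckg: "ck k UNIV g" for k
    unfolding g_def by (rule ck_Suc_imp_ck_deriv[OF ck_bump])
  obtain h where h: "\<And>t. (g has_real_derivative h t) (at t)" "continuous_on UNIV h"
    using ck_Suc_imp_DERIV[OF ckg] ck_Suc_imp_ck_deriv[OF ckg, of 0] by (metis ck.simps(1))
  have g0: "g t = 0" if "t < 1 \<or> t > 2" for t
  proof -
    have "(bump has_real_derivative 0) (at t)"
      by (rule has_field_derivative_transform_within_open[of "\<lambda>t. 0" _ _ "- {1..2}"])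
         (use that in \<open>auto simp: bump_eq_0 open_Compl\<close>)
    with D show ?thesis using DERIV_unique by blast
  qed
  have h0: "h t = 0" if "t < 1 \<or> t > 2" for t
  proof -
    have "(g has_real_derivative 0) (at t)"
      by (rule has_field_derivative_transform_within_open[of "\<lambda>t. 0" _ _ "- {1..2}"])
         (use that g0 in \<open>auto simp: open_Compl\<close>)
    with h(1) show ?thesis using DERIV_unique by blast
  qed
  obtain C where C: "C \<ge> 0" "\<And>t. \<bar>h t\<bar> \<le> C"
    using vanishing_outside_Icc_bounded[OF h(2) h0] by blast
  have lip: "\<bar>g (t + s) - g t\<bar> \<le> C * \<bar>s\<bar>" for t s
    using field_differentiable_bound[of UNIV g h C "t + s" t] h(1) C(2)
    by (auto simp: abs_minus_commute)
  have "\<bar>bump (t + s) - bump t - g t * s\<bar> \<le> C * s\<^sup>2" for t s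
  proof -
    let ?S = "{- \<bar>s\<bar>..\<bar>s\<bar>}"
    have "norm ((bump (t + s) - g t * s) - (bump (t + 0) - g t * 0))
        \<le> (C * \<bar>s\<bar>) * norm (s - 0)"
    proof (rule field_differentiable_bound[of ?S _ "\<lambda>r. g (t + r) - g t"])
      fix r assume r: "r \<in> ?S"
      have "((\<lambda>s. bump (t + s)) has_real_derivative g (t + r) * 1) (at r)"
        by (rule DERIV_chain2[OF D]) (auto intro!: derivative_eq_intros)
      then show "((\<lambda>s. bump (t + s) - g t * s) has_real_derivative g (t + r) - g t) (at r within ?S)"
        by (auto intro!: derivative_eq_intros intro: has_field_derivative_at_within)
      have "\<bar>r\<bar> \<le> \<bar>s\<bar>" using r by auto
      then have "C * \<bar>r\<bar> \<le> C * \<bar>s\<bar>" using C(1) by (rule mult_left_mono)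
      with lip[of t r] show "norm (g (t + r) - g t) \<le> C * \<bar>s\<bar>" by simp
    qed auto
    then show ?thesis by (simp add: power2_eq_square abs_mult_self_eq mult.assoc)
  qed
  with D ckg g0 that show ?thesis by blast
qed


section \<open>Weyl's lemma for the Cauchy--Riemann operator\<close>

text \<open>
  The complex coordinate \<open>zeta\<close>, its squared modulus \<open>qf\<close>, and twice the derivative in the direction of its
  conjugate, \<open>dbar\<close>; the latter annihilates holomorphic functions of \<open>zeta\<close>.
\<close>

definition zeta :: "real \<Rightarrow> plane_fun" where
  "zeta b x = of_real (fst x) + \<i> * of_real (b * snd x)"

definition qf :: "real \<Rightarrow> real \<times> real \<Rightarrow> real" where
  "qf b x = (fst x)\<^sup>2 + (b * snd x)\<^sup>2"

definition dbar :: "real \<Rightarrow> plane_fun \<Rightarrow> plane_fun" where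
  "dbar b f x = pd1 f x + \<i> / of_real b * pd2 f x"

lemma dbar_eqI: "has_pds f p q x \<Longrightarrow> dbar b f x = p + \<i> / of_real b * q"
  by (simp add: dbar_def has_pds_imp_pd1 has_pds_imp_pd2)

lemma integral_dbar_eq_0:
  assumes "test_fun \<psi>"
  shows "(\<integral>x. dbar b \<psi> x \<partial>lborel) = 0"
  unfolding dbar_def
  using assms integrable_test_fun[OF test_fun_pd1] integrable_test_fun[OF test_fun_pd2]
  by (simp add: integral_pd1_eq_0 integral_pd2_eq_0)

lemma norm_zeta: "(cmod (zeta b x))\<^sup>2 = qf b x"
  by (simp add: zeta_def qf_def cmod_power2)

lemma zeta_diff: "zeta b (x - y) = zeta b x - zeta b y"
  by (simp add: zeta_def algebra_simps)

lemma continuous_qf: "continuous_on S (\<lambda>y. qf b (y - x))"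
  unfolding qf_def by (intro continuous_intros)

lemma compact_qf:
  assumes "b > 0"
  shows "compact {y. qf b (y - x) \<le> R}"
proof -
  have "closed {y. qf b (y - x) \<le> R}"
    by (intro closed_Collect_le continuous_qf continuous_on_const)
  moreover have "{y. qf b (y - x) \<le> R} \<subseteq> cball x (sqrt (R + R / b\<^sup>2))"
  proof
    fix y assume "y \<in> {y. qf b (y - x) \<le> R}"
    then have q: "qf b (y - x) \<le> R" by simp
    have "(fst (y - x))\<^sup>2 \<le> R" using q zero_le_power2[of "b * snd (y - x)"] unfolding qf_def by linarith
    moreover have "b\<^sup>2 * (snd (y - x))\<^sup>2 \<le> R"
      using q zero_le_power2[of "fst (y - x)"] unfolding qf_def power_mult_distrib by linarith
    then have "(snd (y - x))\<^sup>2 \<le> R / b\<^sup>2"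
      using assms by (simp add: field_simps)
    ultimately have "(norm (y - x))\<^sup>2 \<le> R + R / b\<^sup>2"
      by (cases "y - x") (auto simp: norm_Pair)
    then show "y \<in> cball x (sqrt (R + R / b\<^sup>2))"
      using real_le_rsqrt by (simp add: dist_norm norm_minus_commute)
  qed
  ultimately show ?thesis
    using bounded_subset[OF bounded_cball] by (simp add: compact_eq_bounded_closed)
qed

lemma has_pds_radial:
  assumes "(f has_real_derivative f') (at (qf b (y - x)))"
  shows "has_pds (\<lambda>y. of_real (f (qf b (y - x))))
    (of_real f' * (2 * of_real (fst y) + of_real (- 2 * fst x)))
    (of_real f' * (2 * of_real b ^ 2 * of_real (snd y) + of_real (- 2 * b\<^sup>2 * snd x))) y"
proof -
  have q: "((\<lambda>y. qf b (y - x)) has_derivative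
      (\<lambda>h. 2 * (fst y - fst x) * fst h + 2 * b\<^sup>2 * (snd y - snd x) * snd h)) (at y)"
    unfolding qf_def
    by (auto intro!: derivative_eq_intros simp: power2_eq_square algebra_simps)
  have "((\<lambda>y. f (qf b (y - x))) has_derivative
      (\<lambda>h. f' * (2 * (fst y - fst x) * fst h + 2 * b\<^sup>2 * (snd y - snd x) * snd h))) (at y)"
    using has_derivative_compose[OF q assms[unfolded has_field_derivative_def]] by simp
  then have "((\<lambda>y. complex_of_real (f (qf b (y - x)))) has_derivative
      (\<lambda>h. of_real (f' * (2 * (fst y - fst x) * fst h + 2 * b\<^sup>2 * (snd y - snd x) * snd h)))) (at y)"
    by (rule has_derivative_of_real)
  then show ?thesis
    unfolding has_pds_def by (simp add: algebra_simps power2_eq_square)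
qed

lemma Ck_radial:
  assumes "\<And>k. ck k UNIV f"
  shows "Ck k (\<lambda>y. of_real (f (qf b (y - x))))"
  using assms
proof (induction k arbitrary: f)
  case 0
  have "continuous_on UNIV f" using 0[of 0] by simp
  then show ?case
    by (auto intro!: continuous_intros continuous_on_compose2[OF _ continuous_qf])
next
  case (Suc k)
  have f': "(f has_real_derivative deriv f t) (at t)" for t
    by (rule ck_Suc_imp_DERIV[OF Suc.prems])
  have IH: "Ck k (\<lambda>y. of_real (deriv f (qf b (y - x))))"
    by (rule Suc.IH[OF ck_Suc_imp_ck_deriv[OF Suc.prems]])
  show ?case
    by (rule CkI[OF has_pds_radial[OF f']
          Ck_mult[OF IH Ck_add[OF Ck_mult[OF Ck_const Ck_fst] Ck_const]]
          Ck_mult[OF IH Ck_add[OF Ck_mult[OF Ck_const Ck_snd] Ck_const]]])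
qed

lemma smooth_radial: "(\<And>k. ck k UNIV f) \<Longrightarrow> smooth (\<lambda>y. of_real (f (qf b (y - x))))"
  unfolding smooth_def using Ck_radial by blast

lemma test_fun_radial:
  assumes "b > 0" "\<And>k. ck k UNIV f" "\<And>t. t > R \<Longrightarrow> f t = 0"
  shows "test_fun (\<lambda>y. of_real (f (qf b (y - x))))"
  by (rule test_funI[OF smooth_radial[OF assms(2)] compact_qf[OF assms(1), of x R]])
     (use assms(3) in simp)

text \<open>
  The scale \<open>e\<close> is measured in units of \<open>qf\<close>, that is, as the square of a length.  Dividing by \<open>e\<close>
  makes the integral over the plane independent of the scale.
\<close>

definition moll :: "real \<Rightarrow> real \<Rightarrow> real \<times> real \<Rightarrow> real" where
  "moll b e w = bump (qf b w / e) / e"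

text \<open>
  Since \<open>dbar\<close> sends \<open>zeta\<close> to \<open>0\<close>, its conjugate to \<open>2\<close> and \<open>G(qf)\<close> to \<open>2 zeta G'(qf)\<close>, the product of the
  conjugate with \<open>G(qf)\<close> is sent to \<open>2 (G(qf) + qf G'(qf))\<close>.  The function \<open>bump_quot e\<close> was built to make
  this the difference of two mollifiers.
\<close>

lemma mollifier_difference_eq_dbar:
  assumes b: "b > 0" and e: "e > 0"
  obtains \<psi> where "test_fun \<psi>"
    "\<And>y. dbar b \<psi> y = 2 * of_real (moll b e (y - x) - moll b 1 (y - x))"
proof -
  obtain g where g: "\<And>t. (bump_quot e has_real_derivative g t) (at t)" "\<And>k. ck k UNIV g"
    "\<And>t. bump_quot e t + t * g t = bump (t / e) / e - bump t"
    using DERIV_bump_quot[OF e] by blast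
  \<comment> \<open>the conjugate of \<open>zeta b (y - x)\<close> as a polynomial in the coordinates of \<open>y\<close>\<close>
  define z where "z = (\<lambda>y::real\<times>real. of_real (fst y) + ((- \<i> * of_real b) * of_real (snd y) + (- cnj (zeta b x))))"
  have z: "z y = cnj (zeta b (y - x))" for y
    by (simp add: z_def zeta_def algebra_simps)
  have smz: "smooth z"
    unfolding z_def by (rule smooth_add[OF smooth_fst smooth_add[OF smooth_mult[OF smooth_const smooth_snd] smooth_const]])
  have pdz: "has_pds z 1 (- \<i> * of_real b) y" for y
    unfolding z_def using has_pds_add[OF has_pds_fst
        has_pds_add[OF has_pds_mult[OF has_pds_const has_pds_snd] has_pds_const],
        of "- \<i> * of_real b" "- cnj (zeta b x)" y] by simp
  define G where "G = (\<lambda>y. complex_of_real (bump_quot e (qf b (y - x))))"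
  have pdG: "has_pds G
      (of_real (g (qf b (y - x))) * (2 * of_real (fst y) + of_real (- 2 * fst x)))
      (of_real (g (qf b (y - x))) * (2 * of_real b ^ 2 * of_real (snd y) + of_real (- 2 * b\<^sup>2 * snd x))) y"
    for y
    unfolding G_def by (rule has_pds_radial[OF g(1)])
  have "test_fun (\<lambda>y. z y * G y)"
    unfolding G_def
    by (rule test_fun_mult[OF smz test_fun_radial[OF b ck_bump_quot[OF e], of "max 2 (2 * e)"]])
       (use bump_quot_eq_0[OF e] in auto)
  moreover have "dbar b (\<lambda>y. z y * G y) y = 2 * of_real (moll b e (y - x) - moll b 1 (y - x))" for y
  proof -
    let ?q = "qf b (y - x)"
    have "dbar b (\<lambda>y. z y * G y) y = 2 * G y + 2 * of_real (g ?q) * (z y * zeta b (y - x))"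
      unfolding dbar_eqI[OF has_pds_mult[OF pdz pdG]]
      using b by (simp add: zeta_def field_simps power2_eq_square)
    also have "z y * zeta b (y - x) = of_real ?q"
      unfolding z norm_zeta[symmetric] by (metis complex_norm_square mult.commute of_real_power)
    also have "2 * G y + 2 * of_real (g ?q) * of_real ?q
        = 2 * of_real (bump_quot e ?q + ?q * g ?q)"
      by (simp add: G_def algebra_simps)
    finally show ?thesis by (simp add: g(3) moll_def)
  qed
  ultimately show ?thesis using that by blast
qed

lemma continuous_moll: "continuous_on S (\<lambda>y. moll b e (y - x))"
proof -
  have *: "continuous_on UNIV (\<lambda>t. bump (t / e) / e)"
  proof (cases "e = 0")
    case False
    then show ?thesis
      by (auto intro!: continuous_intros continuous_on_compose2[OF continuous_bump[of UNIV]])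
  qed simp
  show ?thesis unfolding moll_def
    by (rule continuous_on_compose2[OF * continuous_qf]) simp
qed

lemma moll_eq_0: "e > 0 \<Longrightarrow> qf b w \<ge> 2 * e \<Longrightarrow> moll b e w = 0"
  unfolding moll_def by (simp add: bump_eq_0 field_simps)

lemma moll_nonneg: "e > 0 \<Longrightarrow> moll b e w \<ge> 0"
  unfolding moll_def by (simp add: bump_nonneg)

lemma moll_minus: "moll b e (x - y) = moll b e (y - x)"
  unfolding moll_def qf_def by (simp add: power2_eq_square algebra_simps)

lemma integrable_mult_moll:
  assumes "b > 0" "e > 0" "locally_integrable v"
  shows "integrable lborel (\<lambda>y. v y * of_real (moll b e (y - x)))"
  by (rule integrable_mult_continuous[OF assms(3) compact_qf[OF assms(1), of x "2 * e"]])
     (use assms(2) in \<open>auto intro!: continuous_on_of_real continuous_moll moll_eq_0\<close>)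

definition weakly_dbar_closed :: "real \<Rightarrow> plane_fun \<Rightarrow> bool" where
  "weakly_dbar_closed b v \<longleftrightarrow> (\<forall>\<psi>. test_fun \<psi> \<longrightarrow> (\<integral>y. v y * dbar b \<psi> y \<partial>lborel) = 0)"

lemma weakly_dbar_closed_1: "weakly_dbar_closed b (\<lambda>x. 1)"
  by (simp add: weakly_dbar_closed_def integral_dbar_eq_0)

text \<open>
  This plays the part of the mean value property of holomorphic functions.
\<close>

lemma mollification_indep:
  assumes b: "b > 0" and e: "e > 0" and v: "locally_integrable v" "weakly_dbar_closed b v"
  shows "(\<integral>y. v y * of_real (moll b e (y - x)) \<partial>lborel)
       = (\<integral>y. v y * of_real (moll b 1 (y - x)) \<partial>lborel)"
proof -
  obtain \<psi> where \<psi>: "test_fun \<psi>"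
    "\<And>y. dbar b \<psi> y = 2 * of_real (moll b e (y - x) - moll b 1 (y - x))"
    using mollifier_difference_eq_dbar[OF b e] by blast
  have "0 = (\<integral>y. v y * dbar b \<psi> y \<partial>lborel)"
    using v(2) \<psi>(1) by (simp add: weakly_dbar_closed_def)
  also have "\<dots> = (\<integral>y. 2 * (v y * of_real (moll b e (y - x)) - v y * of_real (moll b 1 (y - x))) \<partial>lborel)"
    by (rule Bochner_Integration.integral_cong) (auto simp: \<psi>(2) algebra_simps)
  also have "\<dots> = 2 * ((\<integral>y. v y * of_real (moll b e (y - x)) \<partial>lborel)
       - (\<integral>y. v y * of_real (moll b 1 (y - x)) \<partial>lborel))"
    using integrable_mult_moll[OF b _ v(1)] e by simp
  finally show ?thesis by simp
qed

definition mass :: "real \<Rightarrow> real" where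
  "mass b = (\<integral>y. moll b 1 y \<partial>lborel)"

lemma integrable_moll:
  assumes "b > 0" "e > 0"
  shows "integrable lborel (\<lambda>y. moll b e (y - x))"
proof -
  have "integrable lborel (\<lambda>y. 1 * complex_of_real (moll b e (y - x)))"
    by (rule integrable_mult_moll[OF assms locally_integrable_continuous]) simp
  from integrable_Re[OF this] show ?thesis by simp
qed

text \<open>
  The constant \<open>1\<close> is a weak solution, so its mollification does not depend on the scale either.
\<close>

lemma integral_moll:
  assumes "b > 0" "e > 0"
  shows "(\<integral>y. moll b e (y - x) \<partial>lborel) = mass b"
proof -
  have "complex_of_real (\<integral>y. moll b e (y - x) \<partial>lborel) = of_real (\<integral>y. moll b 1 (y - x) \<partial>lborel)"
    using mollification_indep[OF assms locally_integrable_continuous weakly_dbar_closed_1]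
    by simp
  then have "(\<integral>y. moll b e (y - x) \<partial>lborel) = (\<integral>y. moll b 1 (y - x) \<partial>lborel)"
    by (simp only: of_real_eq_iff)
  also have "\<dots> = (\<integral>y. moll b 1 (y - x) \<partial>distr lborel borel ((+) x))"
    by (simp only: lborel_distr_plus)
  also have "\<dots> = (\<integral>y. moll b 1 y \<partial>lborel)"
    by (subst integral_distr)
       (auto intro!: borel_measurable_continuous_onI continuous_moll)
  finally show ?thesis by (simp add: mass_def)
qed

lemma mass_pos:
  assumes b: "b > 0"
  shows "mass b > 0"
proof -
  have nn: "moll b 1 y \<ge> 0" for y by (rule moll_nonneg) simp
  have cont: "continuous_on UNIV (moll b 1)"
    using continuous_moll[of UNIV b 1 0] by simp
  have "mass b \<noteq> 0"
  proof
    assume "mass b = 0"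
    then have "AE y in lborel. moll b 1 y = 0"
      unfolding mass_def
      using integral_nonneg_eq_0_iff_AE[of lborel "moll b 1"] integrable_moll[OF b, of 1 0] nn
      by simp
    then have "AE y in lebesgue. y \<in> {y. moll b 1 y = 0}"
      by (simp add: AE_completion)
    moreover have "closed {y. moll b 1 y = 0}"
      by (rule closed_Collect_eq[OF cont continuous_on_const])
    ultimately have "y \<in> {y. moll b 1 y = 0}" for y
      using mem_closed_if_AE_lebesgue by blast
    moreover have "moll b 1 (sqrt (3 / 2), 0) > 0"
      by (simp add: moll_def qf_def bump_pos)
    ultimately show False by (metis less_irrefl mem_Collect_eq)
  qed
  moreover have "mass b \<ge> 0" unfolding mass_def using nn by simp
  ultimately show ?thesis by simp
qed


section \<open>Holomorphy of the mollification\<close>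

lemma has_field_derivative_if_quadratic_remainder:
  fixes f :: "complex \<Rightarrow> complex"
  assumes "\<And>k. cmod k \<le> 1 \<Longrightarrow> cmod (f (z + k) - f z - D * k) \<le> A * (cmod k)\<^sup>2"
  shows "(f has_field_derivative D) (at z)"
proof -
  have "((\<lambda>k. (f (z + k) - f z) / k - D) \<longlongrightarrow> 0) (at 0)"
  proof (rule Lim_null_comparison)
    show "((\<lambda>k::complex. A * cmod k) \<longlongrightarrow> 0) (at 0)"
      by (auto intro!: tendsto_eq_intros)
    have "\<forall>\<^sub>F k::complex in at 0. cmod k \<le> 1"
      unfolding eventually_at by (intro exI[of _ 1]) auto
    moreover have "\<forall>\<^sub>F k::complex in at 0. k \<noteq> 0"
      by (simp add: eventually_at_filter)
    ultimately show "\<forall>\<^sub>F k in at 0. cmod ((f (z + k) - f z) / k - D) \<le> A * cmod k"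
    proof eventually_elim
      case (elim k)
      then have "(f (z + k) - f z) / k - D = (f (z + k) - f z - D * k) / k"
        by (simp add: field_simps)
      also have "cmod \<dots> \<le> A * (cmod k)\<^sup>2 / cmod k"
        unfolding norm_divide by (rule divide_right_mono[OF assms]) (use elim in auto)
      finally show ?case using elim by (simp add: power2_eq_square)
    qed
  qed
  then show ?thesis
    by (simp add: DERIV_def LIM_zero_iff)
qed

definition plane_pt :: "real \<Rightarrow> complex \<Rightarrow> real \<times> real" where
  "plane_pt b z = (Re z, Im z / b)"

lemma plane_pt_zeta: "b \<noteq> 0 \<Longrightarrow> plane_pt b (zeta b x) = x"
  by (simp add: plane_pt_def zeta_def)

lemma zeta_plane_pt: "b \<noteq> 0 \<Longrightarrow> zeta b (plane_pt b z) = z"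
  by (simp add: plane_pt_def zeta_def complex_eq_iff)

definition mollification :: "real \<Rightarrow> plane_fun \<Rightarrow> plane_fun" where
  "mollification b v x = (\<integral>y. v y * of_real (moll b 1 (y - x)) \<partial>lborel)"

text \<open>
  The first-order expansion of the mollifier, with the increment written as a complex number \<open>k\<close>: the
  differential is \<open>- 2 g(qf w) Re (cnj (zeta w) k)\<close> where \<open>g\<close> is the derivative of the bump.
\<close>

lemma mollifier_taylor:
  assumes b: "b > 0"
  obtains g C where "\<And>t. (bump has_real_derivative g t) (at t)" "\<And>k. ck k UNIV g"
    "\<And>t. t > 2 \<Longrightarrow> g t = 0"
    "\<And>w k. cmod k \<le> 1 \<Longrightarrow>
      \<bar>moll b 1 (w - plane_pt b k) - moll b 1 w + 2 * g (qf b w) * Re (cnj (zeta b w) * k)\<bar> \<le> C * (cmod k)\<^sup>2"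
    "\<And>w k. cmod k \<le> 1 \<Longrightarrow> qf b w > 9 \<Longrightarrow>
      moll b 1 (w - plane_pt b k) - moll b 1 w + 2 * g (qf b w) * Re (cnj (zeta b w) * k) = 0"
proof -
  obtain g C where g: "\<And>t. (bump has_real_derivative g t) (at t)" "\<And>k. ck k UNIV g"
    "\<And>t. t < 1 \<or> t > 2 \<Longrightarrow> g t = 0"
    "\<And>t s. \<bar>bump (t + s) - bump t - g t * s\<bar> \<le> C * s\<^sup>2"
    using bump_taylor by blast
  have C: "C \<ge> 0" using g(4)[of 0 1] by (simp add: abs_le_iff)
  have cg: "continuous_on UNIV g" using g(2)[of 0] by simp
  obtain B where B: "B \<ge> 0" "\<And>t. \<bar>g t\<bar> \<le> B"
    using vanishing_outside_Icc_bounded[OF cg g(3)] by blast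
  \<comment> \<open>for \<open>|k| \<le> 1\<close> and \<open>|zeta w| > 3\<close> both points have modulus above 2, beyond the support of the bump\<close>
  have zero: "moll b 1 (w - plane_pt b k) - moll b 1 w + 2 * g (qf b w) * Re (cnj (zeta b w) * k) = 0"
    if k: "cmod k \<le> 1" and w: "qf b w > 9" for w k
  proof -
    have "(cmod (zeta b w))\<^sup>2 > 3\<^sup>2" using w by (simp add: norm_zeta)
    then have "cmod (zeta b w) > 3" by (rule power2_less_imp_less) simp
    then have "cmod (zeta b w - k) > 2"
      using norm_triangle_ineq2[of "zeta b w" k] k by linarith
    then have "(cmod (zeta b w - k))\<^sup>2 \<ge> 2\<^sup>2" by (intro power_mono) auto
    then have "qf b (w - plane_pt b k) \<ge> 2"
      using b by (simp add: norm_zeta[symmetric] zeta_diff zeta_plane_pt)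
    then show ?thesis using w g(3)[of "qf b w"] by (simp add: moll_eq_0)
  qed
  moreover have "\<bar>moll b 1 (w - plane_pt b k) - moll b 1 w + 2 * g (qf b w) * Re (cnj (zeta b w) * k)\<bar>
      \<le> (C * 49 + B) * (cmod k)\<^sup>2" if k: "cmod k \<le> 1" for w k
  proof (cases "qf b w > 9")
    case True
    then show ?thesis using zero[OF k True] C B(1) by simp
  next
    case False
    define s where "s = qf b (w - plane_pt b k) - qf b w"
    have s: "s = (cmod k)\<^sup>2 - 2 * Re (cnj (zeta b w) * k)"
      unfolding s_def norm_zeta[symmetric] zeta_diff using b
      by (simp add: zeta_plane_pt cmod_power2) (simp add: power2_eq_square algebra_simps)
    \<comment> \<open>the increment \<open>s\<close> of \<open>qf\<close> is at most \<open>2 * 3 * |k| + |k|\<^sup>2 \<le> 7 |k|\<close>\<close>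
    have "(cmod (zeta b w))\<^sup>2 \<le> 3\<^sup>2" using False by (simp add: norm_zeta)
    then have z: "cmod (zeta b w) \<le> 3" by (rule power2_le_imp_le) simp
    have "\<bar>Re (cnj (zeta b w) * k)\<bar> \<le> cmod (zeta b w) * cmod k"
      using abs_Re_le_cmod[of "cnj (zeta b w) * k"] by (simp add: norm_mult)
    also have "\<dots> \<le> 3 * cmod k" by (rule mult_right_mono[OF z]) simp
    finally have "\<bar>Re (cnj (zeta b w) * k)\<bar> \<le> 3 * cmod k" .
    moreover have "(cmod k)\<^sup>2 \<le> cmod k"
      using k by (simp add: power2_eq_square mult_left_le)
    ultimately have "\<bar>s\<bar> \<le> 7 * cmod k"
      unfolding s using zero_le_power2[of "cmod k"] by linarith
    then have s2: "s\<^sup>2 \<le> 49 * (cmod k)\<^sup>2"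
      using power_mono[of "\<bar>s\<bar>" "7 * cmod k" 2] by (simp add: power_mult_distrib)
    let ?r = "bump (qf b w + s) - bump (qf b w) - g (qf b w) * s"
    have "\<bar>?r\<bar> \<le> C * (49 * (cmod k)\<^sup>2)"
      by (rule order_trans[OF g(4) mult_left_mono[OF s2 C]])
    moreover have "\<bar>g (qf b w) * (cmod k)\<^sup>2\<bar> \<le> B * (cmod k)\<^sup>2"
      unfolding abs_mult using mult_right_mono[OF B(2), of "(cmod k)\<^sup>2" "qf b w"] by simp
    moreover have "moll b 1 (w - plane_pt b k) - moll b 1 w + 2 * g (qf b w) * Re (cnj (zeta b w) * k)
        = ?r + g (qf b w) * (cmod k)\<^sup>2"
    proof -
      have "bump (qf b (w - plane_pt b k)) = bump (qf b w + s)" by (simp add: s_def)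
      moreover have "g (qf b w) * s = g (qf b w) * (cmod k)\<^sup>2 - 2 * g (qf b w) * Re (cnj (zeta b w) * k)"
        unfolding s by (simp add: algebra_simps)
      ultimately show ?thesis unfolding moll_def div_by_1 by linarith
    qed
    ultimately show ?thesis
      using abs_triangle_ineq[of ?r "g (qf b w) * (cmod k)\<^sup>2"]
      by (simp add: algebra_simps)
  qed
  ultimately show ?thesis
    using that[of g "C * 49 + B"] g(1,2,3) by blast
qed

text \<open>
  The mollifier can be differentiated under the integral sign, and \<open>2 Re (cnj zeta k)\<close> splits the
  differential into a part linear in \<open>k\<close> and a part linear in \<open>cnj k\<close>.  The coefficient of the latter is
  \<open>v\<close> integrated against \<open>dbar\<close> of a test function, up to a factor, hence zero.
\<close>

lemma mollification_holomorphic: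
  assumes b: "b > 0" and v: "locally_integrable v" "weakly_dbar_closed b v"
  shows "(\<lambda>z. mollification b v (plane_pt b z)) holomorphic_on UNIV"
proof -
  obtain g C where g: "\<And>t. (bump has_real_derivative g t) (at t)" "\<And>k. ck k UNIV g"
    "\<And>t. t > 2 \<Longrightarrow> g t = 0"
    and bound: "\<And>w k. cmod k \<le> 1 \<Longrightarrow>
      \<bar>moll b 1 (w - plane_pt b k) - moll b 1 w + 2 * g (qf b w) * Re (cnj (zeta b w) * k)\<bar> \<le> C * (cmod k)\<^sup>2"
    and zero: "\<And>w k. cmod k \<le> 1 \<Longrightarrow> qf b w > 9 \<Longrightarrow>
      moll b 1 (w - plane_pt b k) - moll b 1 w + 2 * g (qf b w) * Re (cnj (zeta b w) * k) = 0"
    using mollifier_taylor[OF b] by blast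
  have "\<exists>D. ((\<lambda>z. mollification b v (plane_pt b z)) has_field_derivative D) (at z)" for z
  proof -
    define x where "x = plane_pt b z"
    define K where "K = {y. qf b (y - x) \<le> 9}"
    have K: "compact K" unfolding K_def by (rule compact_qf[OF b])
    define p where "p = (\<lambda>y. of_real (g (qf b (y - x))) * zeta b (y - x))"
    define p' where "p' = (\<lambda>y. of_real (g (qf b (y - x))) * cnj (zeta b (y - x)))"
    have cg: "continuous_on UNIV (\<lambda>y. g (qf b (y - x)))"
      by (rule continuous_on_compose2[OF _ continuous_qf, of UNIV]) (use g(2)[of 0] in simp_all)
    have cp: "continuous_on UNIV p" "continuous_on UNIV p'"
      unfolding p_def p'_def zeta_def by (intro continuous_intros cg)+
    have p0: "p y = 0" "p' y = 0" if "y \<notin> K" for y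
      using that g(3)[of "qf b (y - x)"] by (auto simp: K_def p_def p'_def)
    have int: "integrable lborel (\<lambda>y. v y * p y)" "integrable lborel (\<lambda>y. v y * p' y)"
      using integrable_mult_continuous[OF v(1) K] cp p0 by blast+
    define D where "D = - (\<integral>y. v y * p' y \<partial>lborel)"
    \<comment> \<open>the coefficient of \<open>cnj k\<close> vanishes because \<open>v\<close> is a weak solution\<close>
    have I: "(\<integral>y. v y * p y \<partial>lborel) = 0"
    proof -
      let ?\<psi> = "\<lambda>y. complex_of_real (bump (qf b (y - x)))"
      have "test_fun ?\<psi>"
        by (rule test_fun_radial[OF b ck_bump, of 2]) (simp add: bump_eq_0)
      then have "(\<integral>y. v y * dbar b ?\<psi> y \<partial>lborel) = 0"
        using v(2) by (simp add: weakly_dbar_closed_def)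
      moreover have "dbar b ?\<psi> y = 2 * p y" for y
        unfolding dbar_eqI[OF has_pds_radial[OF g(1)]] p_def using b
        by (simp add: zeta_def field_simps power2_eq_square)
      moreover have "(\<integral>y. v y * (2 * p y) \<partial>lborel) = 2 * (\<integral>y. v y * p y \<partial>lborel)"
        unfolding integral_mult_right_zero[symmetric] by (simp only: mult.left_commute)
      ultimately show ?thesis by simp
    qed
    have "((\<lambda>z. mollification b v (plane_pt b z)) has_field_derivative D) (at z)"
    proof (rule has_field_derivative_if_quadratic_remainder)
      fix k :: complex assume k: "cmod k \<le> 1"
      define r where "r = (\<lambda>y. moll b 1 (y - x - plane_pt b k) - moll b 1 (y - x)
          + 2 * g (qf b (y - x)) * Re (cnj (zeta b (y - x)) * k))"
      have cr: "continuous_on UNIV r"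
      proof -
        have "continuous_on UNIV (\<lambda>y. moll b 1 (y - x - plane_pt b k))"
          using continuous_moll[of UNIV b 1 "x + plane_pt b k"] by (simp add: diff_diff_eq)
        then show ?thesis
          unfolding r_def zeta_def by (intro continuous_intros cg continuous_moll)
      qed
      have "cmod (\<integral>y. v y * of_real (r y) \<partial>lborel) \<le> (C * (cmod k)\<^sup>2) * (\<integral>y\<in>K. cmod (v y) \<partial>lborel)"
      proof (rule integrable_mult_bounded(2)[OF v(1) K])
        show "(\<lambda>y. complex_of_real (r y)) \<in> borel_measurable borel"
          by (intro borel_measurable_continuous_onI continuous_on_of_real cr)
        show "cmod (of_real (r y)) \<le> C * (cmod k)\<^sup>2" for y
          unfolding norm_of_real r_def by (rule bound[OF k])
        show "complex_of_real (r y) = 0" if "y \<notin> K" for y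
          unfolding of_real_eq_0_iff r_def by (rule zero[OF k]) (use that in \<open>simp add: K_def\<close>)
      qed
      moreover have "(\<integral>y. v y * of_real (r y) \<partial>lborel)
          = mollification b v (plane_pt b (z + k)) - mollification b v (plane_pt b z) - D * k"
      proof -
        have pt: "y - x - plane_pt b k = y - plane_pt b (z + k)" for y
          by (simp add: x_def plane_pt_def prod_eq_iff add_divide_distrib)
        have 2: "complex_of_real (2 * Re (cnj w * k)) = cnj w * k + w * cnj k" for w
          using complex_add_cnj[of "cnj w * k"] by simp
        have "v y * of_real (r y) = v y * of_real (moll b 1 (y - plane_pt b (z + k)))
            - v y * of_real (moll b 1 (y - plane_pt b z)) + (k * (v y * p' y) + cnj k * (v y * p y))" for y
        proof -
          have e: "complex_of_real (r y) = of_real (moll b 1 (y - plane_pt b (z + k)))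
              - of_real (moll b 1 (y - x))
              + of_real (g (qf b (y - x))) * of_real (2 * Re (cnj (zeta b (y - x)) * k))"
            by (simp add: r_def pt)
          show ?thesis unfolding e 2 p_def p'_def x_def by (simp add: algebra_simps)
        qed
        then have "(\<integral>y. v y * of_real (r y) \<partial>lborel)
          = mollification b v (plane_pt b (z + k)) - mollification b v (plane_pt b z)
            + (k * (\<integral>y. v y * p' y \<partial>lborel) + cnj k * (\<integral>y. v y * p y \<partial>lborel))"
          unfolding mollification_def
          using int integrable_mult_moll[OF b _ v(1), of 1] by simp
        then show ?thesis unfolding I D_def by (simp add: algebra_simps)
      qed
      ultimately show "cmod (mollification b v (plane_pt b (z + k)) - mollification b v (plane_pt b z) - D * k)
          \<le> (C * (\<integral>y\<in>K. cmod (v y) \<partial>lborel)) * (cmod k)\<^sup>2"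
        by (simp add: mult_ac)
    qed
    then show ?thesis by blast
  qed
  then show ?thesis
    unfolding holomorphic_on_def field_differentiable_def by simp
qed


section \<open>Mollifications determine the function\<close>

text \<open>
  Boxes form an intersection-stable generator of the Borel sets, and the sets over which the integral
  vanishes are closed under complements and disjoint unions.
\<close>

lemma AE_eq_0_if_box_integrals_eq_0_real:
  fixes f :: "real \<times> real \<Rightarrow> real"
  assumes f: "integrable lborel f"
    and box: "\<And>a c. (\<integral>x\<in>box a c. f x \<partial>lborel) = 0"
    and total: "(\<integral>x. f x \<partial>lborel) = 0"
  shows "AE x in lborel. f x = 0"
proof (rule density_unique_real[OF f integrable_zero])
  fix A :: "(real \<times> real) set" assume "A \<in> sets lborel"
  then have A: "A \<in> sigma_sets UNIV (range (\<lambda>(a, c). box a c))"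
    by (simp add: borel_eq_box)
  have "Int_stable (range (\<lambda>(a, c). box a c :: (real \<times> real) set))"
    by (auto simp: Int_stable_def box_Int_box)
  moreover have "range (\<lambda>(a, c). box a c :: (real \<times> real) set) \<subseteq> Pow UNIV"
    by blast
  ultimately have "(\<integral>x\<in>A. f x \<partial>lborel) = 0"
    using A
  proof (induction rule: sigma_sets_induct_disjoint)
    case (basic A)
    then show ?case using box by auto
  next
    case empty
    show ?case by (simp add: set_lebesgue_integral_def)
  next
    case (compl A)
    have A: "A \<in> sets lborel" using compl(1) by (simp add: borel_eq_box)
    have "(\<integral>x\<in>UNIV - A. f x \<partial>lborel) = (\<integral>x. f x - indicator A x *\<^sub>R f x \<partial>lborel)"
      unfolding set_lebesgue_integral_def
      by (rule Bochner_Integration.integral_cong) (auto simp: indicator_def)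
    also have "\<dots> = (\<integral>x. f x \<partial>lborel) - (\<integral>x\<in>A. f x \<partial>lborel)"
      unfolding set_lebesgue_integral_def
      using f A by (intro Bochner_Integration.integral_diff integrable_mult_indicator)
    finally show ?case using compl(2) total by simp
  next
    case (union A)
    have "range A \<subseteq> sets lborel" using union(2) by (simp add: borel_eq_box)
    then have "(\<integral>x\<in>(\<Union>i. A i). f x \<partial>lborel) = (\<Sum>i. \<integral>x\<in>A i. f x \<partial>lborel)"
    proof (intro lebesgue_integral_countable_add)
      show "set_integrable lborel (\<Union>i. A i) f"
        unfolding set_integrable_def
        by (rule integrable_mult_indicator[OF sets.countable_UN f]) fact
    qed (use \<open>range A \<subseteq> sets lborel\<close> union(1) in \<open>auto simp: disjoint_family_on_def\<close>)
    then show ?case using union(3) by simp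
  qed
  then show "(\<integral>x\<in>A. f x \<partial>lborel) = (\<integral>x\<in>A. 0 \<partial>lborel)"
    by (simp add: set_lebesgue_integral_def)
qed

lemma AE_eq_0_if_box_integrals_eq_0:
  assumes h: "locally_integrable h"
    and box: "\<And>a c. (\<integral>x\<in>box a c. h x \<partial>lborel) = 0"
  shows "AE x in lborel. h x = 0"
proof -
  define S where "S = (\<lambda>n. box (- (real n *\<^sub>R One)) (real n *\<^sub>R One) :: (real \<times> real) set)"
  have int: "integrable lborel (\<lambda>x. indicator (S n) x *\<^sub>R h x)" for n
  proof -
    have "set_integrable lborel (cbox (- (real n *\<^sub>R One)) (real n *\<^sub>R One)) h"
      using h by (simp add: locally_integrable_def compact_cbox)
    then have "set_integrable lborel (S n) h"
      unfolding S_def by (rule set_integrable_subset) (auto simp: box_subset_cbox)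
    then show ?thesis by (simp add: set_integrable_def)
  qed
  have boxS: "(\<integral>x\<in>box a c. indicator (S n) x *\<^sub>R h x \<partial>lborel) = 0" for a c n
  proof -
    obtain p q where pq: "box a c \<inter> S n = box p q"
      unfolding S_def box_Int_box by blast
    have "(\<integral>x\<in>box a c. indicator (S n) x *\<^sub>R h x \<partial>lborel) = (\<integral>x\<in>box p q. h x \<partial>lborel)"
      unfolding pq[symmetric] set_lebesgue_integral_def
      by (rule Bochner_Integration.integral_cong) (auto simp: indicator_def)
    then show ?thesis by (simp add: box)
  qed
  have tot: "(\<integral>x. indicator (S n) x *\<^sub>R h x \<partial>lborel) = 0" for n
    using box unfolding S_def set_lebesgue_integral_def by blast
  have AE_real: "AE x in lborel. L (indicator (S n) x *\<^sub>R h x) = 0"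
    if L: "bounded_linear L" for L :: "complex \<Rightarrow> real" and n
  proof (rule AE_eq_0_if_box_integrals_eq_0_real)
    show "integrable lborel (\<lambda>x. L (indicator (S n) x *\<^sub>R h x))"
      by (rule integrable_bounded_linear[OF L int])
    show "(\<integral>x. L (indicator (S n) x *\<^sub>R h x) \<partial>lborel) = 0"
      using integral_bounded_linear[OF L int[of n]] tot[of n] linear_0[OF bounded_linear.linear[OF L]] by simp
    fix a c
    have "integrable lborel (\<lambda>x. indicator (box a c) x *\<^sub>R (indicator (S n) x *\<^sub>R h x))"
      by (rule integrable_mult_indicator[OF _ int]) simp
    from integral_bounded_linear[OF L this]
    show "(\<integral>x\<in>box a c. L (indicator (S n) x *\<^sub>R h x) \<partial>lborel) = 0"
      using boxS[of a c n] linear_0[OF bounded_linear.linear[OF L]]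
        linear_scale[OF bounded_linear.linear[OF L]]
      unfolding set_lebesgue_integral_def by (simp add: mult.assoc)
  qed
  have "AE x in lborel. \<forall>n. Re (indicator (S n) x *\<^sub>R h x) = 0 \<and> Im (indicator (S n) x *\<^sub>R h x) = 0"
    using AE_real[OF bounded_linear_Re] AE_real[OF bounded_linear_Im]
    by (simp only: AE_all_countable AE_conj_iff simp_thms)
  then show ?thesis
  proof eventually_elim
    case (elim x)
    have "(\<Union>n. S n) = UNIV" unfolding S_def by (rule UN_box_eq_UNIV)
    then obtain n where "x \<in> S n" by blast
    with elim show ?case using spec[OF elim, of n] by (simp add: complex_eq_iff)
  qed
qed

lemma moll_bounded:
  obtains M where "\<And>w. \<bar>moll b e w\<bar> \<le> M"
proof -
  obtain B where "\<And>t. \<bar>bump t\<bar> \<le> B"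
    using vanishing_outside_Icc_bounded[OF continuous_bump, of 1 2] bump_eq_0 less_imp_le by metis
  then have "\<bar>moll b e w\<bar> \<le> B / \<bar>e\<bar>" for w
    unfolding moll_def abs_divide by (intro divide_right_mono) auto
  then show ?thesis using that by blast
qed

lemma moll_eq_0_scaled:
  assumes "b > 0" "0 < e" "norm w \<ge> sqrt (2 * e) * (1 + 1 / b)"
  shows "moll b e w = 0"
proof (rule moll_eq_0[OF assms(2)], rule ccontr)
  assume "\<not> 2 * e \<le> qf b w"
  then have q: "qf b w < (sqrt (2 * e))\<^sup>2" using assms by simp
  have "(fst w)\<^sup>2 < (sqrt (2 * e))\<^sup>2"
    using q zero_le_power2[of "b * snd w"] unfolding qf_def by linarith
  moreover have "(b * snd w)\<^sup>2 < (sqrt (2 * e))\<^sup>2"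
    using q zero_le_power2[of "fst w"] unfolding qf_def by linarith
  ultimately have *: "\<bar>fst w\<bar> < sqrt (2 * e)" "\<bar>b * snd w\<bar> < sqrt (2 * e)"
    using power2_less_imp_less[of "\<bar>fst w\<bar>" "sqrt (2 * e)"]
      power2_less_imp_less[of "\<bar>b * snd w\<bar>" "sqrt (2 * e)"] assms(2) by auto
  then have "\<bar>snd w\<bar> < sqrt (2 * e) / b"
    using assms(1) by (simp add: abs_mult field_simps)
  moreover have "norm w \<le> \<bar>fst w\<bar> + \<bar>snd w\<bar>"
    using norm_Pair_le[of "fst w" "snd w"] by simp
  ultimately show False using assms(3) * by (simp add: algebra_simps)
qed

lemma moll_eq_0_far:
  assumes "b > 0" "0 < e" "e \<le> 1" "norm w \<ge> 2 * (1 + 1 / b)"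
  shows "moll b e w = 0"
proof (rule moll_eq_0_scaled[OF assms(1,2)])
  have "sqrt (2 * e) \<le> 2" using assms(3) by (intro real_le_lsqrt) (use assms(2) in auto)
  then have "sqrt (2 * e) * (1 + 1 / b) \<le> 2 * (1 + 1 / b)"
    using assms(1) by (intro mult_right_mono) auto
  with assms(4) show "sqrt (2 * e) * (1 + 1 / b) \<le> norm w" by linarith
qed

text \<open>
  Away from the frontier of the box, a mollifier of small enough scale centred at \<open>y\<close> lives either
  entirely inside or entirely outside the box.
\<close>

lemma box_integral_moll_tendsto:
  assumes b: "b > 0" and y: "y \<notin> frontier (box a c)"
  shows "(\<lambda>n. \<integral>x\<in>box a c. moll b (1 / real (Suc n)) (y - x) \<partial>lborel)
           \<longlonglongrightarrow> mass b * indicator (box a c) y"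
proof -
  let ?S = "box a c :: (real \<times> real) set"
  have "\<exists>r>0. ball y r \<subseteq> ?S \<or> ball y r \<inter> ?S = {}"
  proof (cases "y \<in> ?S")
    case True
    then show ?thesis using open_contains_ball[of ?S] by blast
  next
    case False
    then have "y \<in> - closure ?S" using y interior_subset[of ?S] by (auto simp: frontier_def)
    then obtain r where "r > 0" "ball y r \<subseteq> - closure ?S"
      using open_contains_ball[of "- closure ?S"] by auto
    then show ?thesis using closure_subset[of ?S] by blast
  qed
  then obtain r where r: "r > 0" "ball y r \<subseteq> ?S \<or> ball y r \<inter> ?S = {}" by blast
  have "(\<lambda>n. sqrt (2 * (1 / real (Suc n))) * (1 + 1 / b)) \<longlonglongrightarrow> sqrt (2 * 0) * (1 + 1 / b)"
    by (intro tendsto_intros LIMSEQ_Suc[OF lim_1_over_n])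
  then have "\<forall>\<^sub>F n in sequentially. sqrt (2 * (1 / real (Suc n))) * (1 + 1 / b) < r"
    by (rule order_tendstoD(2)) (use r(1) in simp)
  then have "\<forall>\<^sub>F n in sequentially.
      (\<integral>x\<in>?S. moll b (1 / real (Suc n)) (y - x) \<partial>lborel) = mass b * indicator ?S y"
  proof eventually_elim
    case (elim n)
    let ?e = "1 / real (Suc n)"
    have far: "moll b ?e (y - x) = 0" if "x \<notin> ball y r" for x
      by (rule moll_eq_0_scaled[OF b]) (use elim that in \<open>auto simp: dist_norm\<close>)
    have "(\<integral>x\<in>?S. moll b ?e (y - x) \<partial>lborel)
        = (\<integral>x. indicator ?S y *\<^sub>R moll b ?e (x - y) \<partial>lborel)"
      unfolding set_lebesgue_integral_def
    proof (rule Bochner_Integration.integral_cong)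
      fix x
      show "indicator ?S x *\<^sub>R moll b ?e (y - x) = indicator ?S y *\<^sub>R moll b ?e (x - y)"
      proof (cases "x \<in> ball y r")
        case True
        moreover have "y \<in> ball y r" using r(1) by simp
        ultimately have "x \<in> ?S \<longleftrightarrow> y \<in> ?S"
          using r(2) by blast
        then show ?thesis by (simp only: indicator_def moll_minus[of b ?e y x])
      next
        case False
        then show ?thesis using far[OF False] moll_minus[of b ?e y x] by simp
      qed
    qed simp
    then show ?case using integral_moll[OF b, of ?e y] by (simp add: mult.commute)
  qed
  then show ?thesis by (rule tendsto_eventually)
qed

text \<open>
  By Fubini the mollifier is moved from \<open>v\<close> to the indicator of the box.  The left-hand side is the
  same for every scale, so the scale may tend to \<open>0\<close> on the right, under the integral sign by dominated
  convergence.
\<close>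

lemma box_integral_mollification:
  assumes b: "b > 0" and v: "locally_integrable v" "weakly_dbar_closed b v"
  shows "(\<integral>x\<in>box a c. mollification b v x \<partial>lborel) = of_real (mass b) * (\<integral>y\<in>box a c. v y \<partial>lborel)"
proof -
  let ?S = "box a c :: (real \<times> real) set"
  obtain R where R: "\<And>x. x \<in> ?S \<Longrightarrow> norm x \<le> R"
    using bounded_box[of a c] by (auto simp: bounded_iff)
  \<comment> \<open>mollifiers of scale at most 1 centred in the box vanish outside \<open>K\<close>\<close>
  define K where "K = cball (0 :: real \<times> real) (R + (2 * (1 + 1 / b)))"
  have K: "compact K" by (simp add: K_def)
  have vm [measurable]: "v \<in> borel_measurable borel"
    and vK: "integrable lborel (\<lambda>y. indicator K y *\<^sub>R v y)"
    using v(1) K by (auto simp: locally_integrable_def set_integrable_def)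
  have Kout: "moll b e (y - x) = 0" if "x \<in> ?S" "y \<notin> K" "0 < e" "e \<le> 1" for x y e
  proof (rule moll_eq_0_far[OF b that(3,4)])
    have "norm y \<le> norm x + norm (y - x)" using norm_triangle_ineq[of x "y - x"] by simp
    then show "2 * (1 + 1 / b) \<le> norm (y - x)"
      using R[OF that(1)] that(2) by (simp add: K_def)
  qed
  define G where "G = (\<lambda>n y. \<integral>x\<in>?S. moll b (1 / real (Suc n)) (y - x) \<partial>lborel)"
  have swap: "(\<integral>x\<in>?S. mollification b v x \<partial>lborel) = (\<integral>y. v y * of_real (G n y) \<partial>lborel)" for n
  proof -
    let ?e = "1 / real (Suc n)"
    have e: "?e > 0" "?e \<le> 1" by auto
    obtain M where M: "\<And>w. \<bar>moll b ?e w\<bar> \<le> M" using moll_bounded by blast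
    define f where "f = (\<lambda>x y. indicator ?S x *\<^sub>R (v y * complex_of_real (moll b ?e (y - x))))"
    have [measurable]: "(\<lambda>p. moll b ?e (snd p - fst p)) \<in> borel_measurable (lborel \<Otimes>\<^sub>M lborel)"
    proof -
      have "moll b ?e \<in> borel_measurable borel"
        using borel_measurable_continuous_onI[OF continuous_moll[of UNIV b ?e 0]] by simp
      then show ?thesis by measurable
    qed
    have fm: "(\<lambda>p. f (fst p) (snd p)) \<in> borel_measurable (lborel \<Otimes>\<^sub>M lborel)"
      unfolding f_def by measurable
    have fint: "integrable lborel (f x)" for x
      unfolding f_def using integrable_mult_moll[OF b e(1) v(1)] by simp
    have bd: "cmod (f x y) \<le> M * (indicator ?S x * cmod (indicator K y *\<^sub>R v y))" for x y
    proof (cases "x \<in> ?S \<and> y \<in> K")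
      case True
      then show ?thesis
        using mult_left_mono[OF M[of "y - x"], of "cmod (v y)"]
        by (simp add: f_def norm_mult mult.commute)
    next
      case False
      then have "f x y = 0"
        using Kout[OF _ _ e, of x y] by (cases "x \<in> ?S") (auto simp: f_def)
      moreover have "indicator ?S x * cmod (indicator K y *\<^sub>R v y) = 0"
        using False by (auto simp: indicator_def)
      ultimately show ?thesis by (simp only: norm_zero mult_zero_right order_refl)
    qed
    have "integrable (lborel \<Otimes>\<^sub>M lborel) (case_prod f)"
    proof (rule lborel_pair.Fubini_integrable)
      show "case_prod f \<in> borel_measurable (lborel \<Otimes>\<^sub>M lborel)"
        using fm by (simp add: case_prod_beta')
      show "AE x in lborel. integrable lborel (\<lambda>y. case_prod f (x, y))"
        using fint by simp
      have "integrable lborel (\<lambda>x. (M * (\<integral>y. cmod (indicator K y *\<^sub>R v y) \<partial>lborel)) * indicator ?S x)"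
        by (intro integrable_mult_right integrable_real_indicator) (auto simp: emeasure_lborel_box_eq)
      then show "integrable lborel (\<lambda>x. \<integral>y. cmod (case_prod f (x, y)) \<partial>lborel)"
      proof (rule Bochner_Integration.integrable_bound)
        show "(\<lambda>x. \<integral>y. cmod (case_prod f (x, y)) \<partial>lborel) \<in> borel_measurable lborel"
          using fm by (simp add: case_prod_beta') measurable
        show "AE x in lborel. norm (\<integral>y. cmod (case_prod f (x, y)) \<partial>lborel)
            \<le> norm ((M * (\<integral>y. cmod (indicator K y *\<^sub>R v y) \<partial>lborel)) * indicator ?S x)"
        proof (rule AE_I2)
          fix x
          have "(\<integral>y. cmod (f x y) \<partial>lborel)
              \<le> (\<integral>y. M * (indicator ?S x * cmod (indicator K y *\<^sub>R v y)) \<partial>lborel)"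
            by (rule integral_mono[OF integrable_norm[OF fint]
                  integrable_mult_right[OF integrable_mult_right[OF integrable_norm[OF vK]]] bd])
          then have "(\<integral>y. cmod (f x y) \<partial>lborel)
              \<le> (M * (\<integral>y. cmod (indicator K y *\<^sub>R v y) \<partial>lborel)) * indicator ?S x"
            unfolding integral_mult_right_zero by (simp only: mult_ac)
          moreover have "0 \<le> (\<integral>y. cmod (f x y) \<partial>lborel)" by simp
          ultimately show "norm (\<integral>y. cmod (case_prod f (x, y)) \<partial>lborel)
            \<le> norm ((M * (\<integral>y. cmod (indicator K y *\<^sub>R v y) \<partial>lborel)) * indicator ?S x)"
            unfolding real_norm_def by (simp add: abs_le_iff)
        qed
      qed
    qed
    from lborel_pair.Fubini_integral[OF this]
    have "(\<integral>x. (\<integral>y. f x y \<partial>lborel) \<partial>lborel) = (\<integral>y. (\<integral>x. f x y \<partial>lborel) \<partial>lborel)" by simp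
    moreover have "(\<integral>y. f x y \<partial>lborel) = indicator ?S x *\<^sub>R mollification b v x" for x
      unfolding f_def mollification_def mollification_indep[OF b e(1) v, symmetric] by simp
    moreover have "(\<integral>x. f x y \<partial>lborel) = v y * of_real (G n y)" for y
    proof -
      have fxy: "f x y = v y * of_real (indicator ?S x *\<^sub>R moll b ?e (y - x))" for x
        by (simp add: f_def scaleR_conv_of_real mult_ac)
      show ?thesis
        unfolding fxy G_def set_lebesgue_integral_def integral_mult_right_zero integral_complex_of_real ..
    qed
    ultimately show ?thesis unfolding set_lebesgue_integral_def by simp
  qed
  have "(\<lambda>n. \<integral>y. v y * of_real (G n y) \<partial>lborel)
      \<longlonglongrightarrow> (\<integral>y. v y * of_real (mass b * indicator ?S y) \<partial>lborel)"
  proof (rule integral_dominated_convergence[where w = "\<lambda>y. mass b * cmod (indicator K y *\<^sub>R v y)"])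
    show Gm: "(\<lambda>y. v y * of_real (G n y)) \<in> borel_measurable lborel" for n
    proof -
      have "moll b (1 / real (Suc n)) \<in> borel_measurable borel"
        using borel_measurable_continuous_onI[OF continuous_moll[of UNIV b _ 0]] by simp
      then show ?thesis unfolding G_def set_lebesgue_integral_def by measurable
    qed
    show "(\<lambda>y. v y * of_real (mass b * indicator ?S y)) \<in> borel_measurable lborel" by measurable
    show "integrable lborel (\<lambda>y. mass b * cmod (indicator K y *\<^sub>R v y))"
      using vK by (intro integrable_mult_right integrable_norm)
    have "negligible (frontier ?S)"
      by (rule negligible_convex_frontier) simp
    then have "AE y in lborel. y \<notin> frontier ?S"
      unfolding negligible_iff_null_sets
      by (metis AE_completion_iff AE_not_in)
    then show "AE y in lborel. (\<lambda>n. v y * of_real (G n y)) \<longlonglongrightarrow> v y * of_real (mass b * indicator ?S y)"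
    proof eventually_elim
      case (elim y)
      show ?case unfolding G_def
        by (intro tendsto_mult tendsto_const tendsto_of_real box_integral_moll_tendsto[OF b elim])
    qed
    show "AE y in lborel. norm (v y * of_real (G n y)) \<le> mass b * cmod (indicator K y *\<^sub>R v y)" for n
    proof (rule AE_I2)
      fix y
      let ?e = "1 / real (Suc n)"
      have e: "?e > 0" "?e \<le> 1" by auto
      show "norm (v y * of_real (G n y)) \<le> mass b * cmod (indicator K y *\<^sub>R v y)"
      proof (cases "y \<in> K")
        case True
        have int: "integrable lborel (\<lambda>x. moll b ?e (y - x))"
          using integrable_moll[OF b e(1), of y] by (simp add: moll_minus)
        have "G n y \<le> (\<integral>x. moll b ?e (y - x) \<partial>lborel)"
          unfolding G_def set_lebesgue_integral_def
          by (rule integral_mono[OF integrable_mult_indicator[OF _ int] int])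
             (auto simp: indicator_def moll_nonneg)
        also have "\<dots> = mass b" using integral_moll[OF b e(1), of y] by (simp add: moll_minus)
        finally have "G n y \<le> mass b" .
        moreover have "G n y \<ge> 0"
          unfolding G_def set_lebesgue_integral_def by (simp add: moll_nonneg)
        ultimately show ?thesis
          using True mult_left_mono[of "G n y" "mass b" "cmod (v y)"]
          by (simp add: norm_mult mult.commute)
      next
        case False
        then have z: "indicator ?S x *\<^sub>R moll b ?e (y - x) = 0" for x
          using Kout[OF _ False e] by (cases "x \<in> ?S") auto
        have "G n y = 0"
          unfolding G_def set_lebesgue_integral_def z by (rule Bochner_Integration.integral_zero)
        then show ?thesis using False by simp
      qed
    qed
  qed
  then have "(\<integral>x\<in>?S. mollification b v x \<partial>lborel) = (\<integral>y. v y * of_real (mass b * indicator ?S y) \<partial>lborel)"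
    unfolding swap[symmetric] by (rule LIMSEQ_unique[OF tendsto_const])
  also have "\<dots> = (\<integral>y. of_real (mass b) * (indicator ?S y *\<^sub>R v y) \<partial>lborel)"
    by (rule Bochner_Integration.integral_cong) (auto simp: indicator_def)
  also have "\<dots> = of_real (mass b) * (\<integral>y\<in>?S. v y \<partial>lborel)"
    unfolding set_lebesgue_integral_def by (rule integral_mult_right_zero)
  finally show ?thesis .
qed

text \<open>
  The entire function is the mollification of \<open>v\<close> divided by the mass of the mollifier; it has the
  same integral as \<open>v\<close> over every box.
\<close>

theorem weyl_lemma:
  assumes b: "b > 0" and v: "locally_integrable v" "weakly_dbar_closed b v"
  shows "\<exists>F. F holomorphic_on UNIV \<and> (AE x in lborel. v x = F (zeta b x))"
proof -
  define F where "F = (\<lambda>z. mollification b v (plane_pt b z) / of_real (mass b))"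
  have F: "F holomorphic_on UNIV"
    unfolding F_def using mollification_holomorphic[OF b v] mass_pos[OF b]
    by (intro holomorphic_intros) auto
  have Fz: "F (zeta b x) = mollification b v x / of_real (mass b)" for x
    using b by (simp add: F_def plane_pt_zeta)
  have lF: "locally_integrable (\<lambda>x. F (zeta b x))"
    by (rule locally_integrable_continuous)
       (auto intro!: continuous_on_compose2[OF holomorphic_on_imp_continuous_on[OF F]]
          continuous_intros simp: zeta_def)
  have "AE x in lborel. v x - F (zeta b x) = 0"
  proof (rule AE_eq_0_if_box_integrals_eq_0[OF locally_integrable_diff[OF v(1) lF]])
    fix a c :: "real \<times> real"
    have si: "set_integrable lborel (box a c) w" if "locally_integrable w" for w
      using that compact_cbox[of a c] set_integrable_subset[OF _ _ box_subset_cbox, of lborel a c w]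
      by (simp add: locally_integrable_def)
    have "(\<integral>x\<in>box a c. F (zeta b x) \<partial>lborel) = (\<integral>x\<in>box a c. v x \<partial>lborel)"
      unfolding Fz using box_integral_mollification[OF b v, of a c] mass_pos[OF b]
      by (simp add: field_simps)
    then show "(\<integral>x\<in>box a c. v x - F (zeta b x) \<partial>lborel) = 0"
      using set_integral_diff(2)[OF si[OF v(1)] si[OF lF]] by simp
  qed
  with F show ?thesis by auto
qed


section \<open>Square-integrable functions as distributions\<close>

text \<open>
  Fubini's theorem is applied to Borel functions on a product, so Lebesgue measurable functions are
  replaced by Borel representatives.
\<close>

lemma L2_borel_representative:
  assumes "u \<in> L2"
  obtains u0 where "u0 \<in> borel_measurable borel" "AE x in lebesgue. u x = u0 x"
    "integrable lborel (\<lambda>x. (cmod (u0 x))\<^sup>2)"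
proof -
  have um: "u \<in> borel_measurable lebesgue" and ui: "integrable lebesgue (\<lambda>x. (cmod (u x))\<^sup>2)"
    using assms by (auto simp: L2_def)
  have Re_Im: "(\<lambda>x. Re (u x)) \<in> borel_measurable lebesgue" "(\<lambda>x. Im (u x)) \<in> borel_measurable lebesgue"
    using um by measurable
  obtain r where r: "r \<in> borel_measurable lborel" "AE x in lborel. Re (u x) = r x"
    using completion_ex_borel_measurable_real[OF Re_Im(1)] by blast
  obtain i where i: "i \<in> borel_measurable lborel" "AE x in lborel. Im (u x) = i x"
    using completion_ex_borel_measurable_real[OF Re_Im(2)] by blast
  define u0 where "u0 = (\<lambda>x. Complex (r x) (i x))"
  have u0: "u0 \<in> borel_measurable borel"
    unfolding u0_def Complex_eq using r(1) i(1) by measurable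
  have "AE x in lborel. u x = u0 x"
    using r(2) i(2) by eventually_elim (simp add: u0_def complex_eq_iff)
  then have ae: "AE x in lebesgue. u x = u0 x" by (rule AE_completion)
  have "integrable lebesgue (\<lambda>x. (cmod (u0 x))\<^sup>2)"
    by (rule integrable_cong_AE_imp[OF ui])
       (use u0 ae in \<open>auto intro: measurable_completion elim: eventually_mono\<close>)
  then have "integrable lborel (\<lambda>x. (cmod (u0 x))\<^sup>2)"
    by (subst (asm) integrable_completion) (use u0 in measurable)
  with u0 ae that show ?thesis by blast
qed

lemma locally_integrable_if_square_integrable:
  assumes [measurable]: "w \<in> borel_measurable borel" and w: "integrable lborel (\<lambda>x. (cmod (w x))\<^sup>2)"
  shows "locally_integrable w"
  unfolding locally_integrable_def
proof (intro conjI allI impI)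
  fix K :: "(real \<times> real) set" assume K: "compact K"
  have [measurable]: "K \<in> sets borel" using K by (rule compact_imp_sets_borel)
  have "integrable lborel (indicator K :: real \<times> real \<Rightarrow> real)"
    using K by (intro integrable_real_indicator emeasure_compact_finite) auto
  then have "integrable lborel (\<lambda>x. indicator K x + (cmod (w x))\<^sup>2)"
    using w by (rule Bochner_Integration.integrable_add)
  then show "set_integrable lborel K w"
    unfolding set_integrable_def
  proof (rule Bochner_Integration.integrable_bound)
    show "AE x in lborel. norm (indicator K x *\<^sub>R w x) \<le> norm (indicator K x + (cmod (w x))\<^sup>2)"
    proof (rule AE_I2)
      fix x
      have "cmod (w x) \<le> 1 + (cmod (w x))\<^sup>2"
        using sum_squares_bound[of 1 "cmod (w x)"] norm_ge_zero[of "w x"]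
        unfolding power_one mult_1_right by linarith
      then show "norm (indicator K x *\<^sub>R w x) \<le> norm (indicator K x + (cmod (w x))\<^sup>2)"
        by (simp add: indicator_def)
    qed
  qed measurable
qed (fact assms(1))

lemma locally_integrable_mult_continuous:
  assumes v: "locally_integrable v" and g: "continuous_on UNIV g"
  shows "locally_integrable (\<lambda>x. v x * g x)"
  unfolding locally_integrable_def
proof (intro conjI allI impI)
  have [measurable]: "v \<in> borel_measurable borel" "g \<in> borel_measurable borel"
    using v g by (auto simp: locally_integrable_def borel_measurable_continuous_onI)
  show "(\<lambda>x. v x * g x) \<in> borel_measurable borel" by measurable
  fix K :: "(real \<times> real) set" assume K: "compact K"
  have [measurable]: "K \<in> sets borel" using K by (rule compact_imp_sets_borel)
  obtain C where C: "\<And>x. x \<in> K \<Longrightarrow> cmod (g x) \<le> C"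
    using compact_continuous_bound[OF K g] by blast
  have "integrable lborel (\<lambda>x. v x * (indicator K x *\<^sub>R g x))"
    by (rule integrable_mult_bounded(1)[OF v K, of _ C]) (use C in auto)
  then show "set_integrable lborel K (\<lambda>x. v x * g x)"
    unfolding set_integrable_def by simp
qed

lemma dist_of_fun_eq_lborel:
  assumes "u \<in> borel_measurable lebesgue" "u0 \<in> borel_measurable borel" "AE x in lebesgue. u x = u0 x"
    "test_fun \<phi>"
  shows "dist_of_fun u \<phi> = (\<integral>x. u0 x * \<phi> x \<partial>lborel)"
proof -
  have \<phi>: "\<phi> \<in> borel_measurable borel"
    by (rule borel_measurable_continuous_onI[OF test_fun_continuous[OF assms(4)]])
  have "\<phi> \<in> borel_measurable lebesgue" "u0 \<in> borel_measurable lebesgue"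
    using \<phi> assms(2) by (auto intro: measurable_completion)
  then have "dist_of_fun u \<phi> = (\<integral>x. u0 x * \<phi> x \<partial>lebesgue)"
    unfolding dist_of_fun_def
    by (intro integral_cong_AE borel_measurable_times assms(1))
       (use assms(3) in \<open>auto elim: eventually_mono\<close>)
  also have "\<dots> = (\<integral>x. u0 x * \<phi> x \<partial>lborel)"
    by (rule integral_completion) (use \<phi> assms(2) in measurable)
  finally show ?thesis .
qed

lemma test_fun_add: "test_fun \<phi> \<Longrightarrow> test_fun \<psi> \<Longrightarrow> test_fun (\<lambda>x. \<phi> x + \<psi> x)"
  by (rule test_funI[of _ "supp \<phi> \<union> supp \<psi>"])
     (auto simp: test_fun_def smooth_add eq_0_outside_supp)

lemma test_fun_cmult: "test_fun \<phi> \<Longrightarrow> test_fun (\<lambda>x. a * \<phi> x)"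
  by (rule test_fun_mult[OF smooth_const])

text \<open>
  The distribution has order zero: the supremum of the test function itself suffices in the estimate.
\<close>

lemma distribution_dist_of_fun:
  assumes "u \<in> L2"
  shows "distribution (dist_of_fun u)"
proof -
  obtain u0 where u0: "u0 \<in> borel_measurable borel" "AE x in lebesgue. u x = u0 x"
    "integrable lborel (\<lambda>x. (cmod (u0 x))\<^sup>2)"
    using L2_borel_representative[OF assms] by blast
  have um: "u \<in> borel_measurable lebesgue" using assms by (simp add: L2_def)
  note T = dist_of_fun_eq_lborel[OF um u0(1,2)]
  have lu0: "locally_integrable u0"
    by (rule locally_integrable_if_square_integrable[OF u0(1,3)])
  note int = integrable_mult_test_fun[OF lu0]
  show ?thesis
    unfolding distribution_def
  proof (intro conjI allI impI)
    fix \<phi> \<psi> assume "test_fun \<phi>" "test_fun \<psi>"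
    then show "dist_of_fun u (\<lambda>x. \<phi> x + \<psi> x) = dist_of_fun u \<phi> + dist_of_fun u \<psi>"
      using int by (simp add: T test_fun_add distrib_left)
  next
    fix a \<phi> assume \<phi>: "test_fun \<phi>"
    have "(\<integral>x. u0 x * (a * \<phi> x) \<partial>lborel) = a * (\<integral>x. u0 x * \<phi> x \<partial>lborel)"
      unfolding integral_mult_right_zero[symmetric] by (simp only: mult.left_commute)
    then show "dist_of_fun u (\<lambda>x. a * \<phi> x) = a * dist_of_fun u \<phi>"
      using \<phi> by (simp add: T test_fun_cmult)
  next
    fix K :: "(real \<times> real) set" assume K: "compact K"
    show "\<exists>C N. \<forall>\<phi>. test_fun \<phi> \<longrightarrow> supp \<phi> \<subseteq> K \<longrightarrow>
      cmod (dist_of_fun u \<phi>) \<le> C * (\<Sum>(i, j)\<in>{(i, j). i + j \<le> N}. SUP x. cmod ((pd1 ^^ i) ((pd2 ^^ j) \<phi>) x))"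
    proof (rule exI[of _ "\<integral>x\<in>K. cmod (u0 x) \<partial>lborel"], rule exI[of _ 0], intro allI impI)
      fix \<phi> assume \<phi>: "test_fun \<phi>" and sK: "supp \<phi> \<subseteq> K"
      obtain B where B: "\<And>x. x \<in> K \<Longrightarrow> cmod (\<phi> x) \<le> B"
        using compact_continuous_bound[OF K test_fun_continuous[OF \<phi>]] by blast
      have 0: "\<phi> x = 0" if "x \<notin> K" for x
        using that sK eq_0_outside_supp by blast
      have "cmod (\<phi> x) \<le> max 0 B" for x
        using B[of x] 0[of x] by (cases "x \<in> K") (auto simp: max.coboundedI2)
      then have bdd: "bdd_above (range (\<lambda>x. cmod (\<phi> x)))" by (auto simp: bdd_above_def)
      have "cmod (\<integral>x. u0 x * \<phi> x \<partial>lborel) \<le> (SUP x. cmod (\<phi> x)) * (\<integral>x\<in>K. cmod (u0 x) \<partial>lborel)"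
      proof (rule integrable_mult_bounded(2)[OF lu0 K _ _ 0])
        show "\<phi> \<in> borel_measurable borel"
          by (rule borel_measurable_continuous_onI[OF test_fun_continuous[OF \<phi>]])
        show "cmod (\<phi> x) \<le> (SUP x. cmod (\<phi> x))" for x
          by (rule cSUP_upper[OF UNIV_I bdd])
      qed
      moreover have "{(i, j). i + j \<le> (0::nat)} = {(0, 0)}" by auto
      ultimately show "cmod (dist_of_fun u \<phi>) \<le> (\<integral>x\<in>K. cmod (u0 x) \<partial>lborel) *
          (\<Sum>(i, j)\<in>{(i, j). i + j \<le> 0}. SUP x. cmod ((pd1 ^^ i) ((pd2 ^^ j) \<phi>) x))"
        using T[OF \<phi>] by (simp add: mult.commute)
    qed
  qed
qed

lemma L2_add:
  assumes "u \<in> L2" "w \<in> L2"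
  shows "(\<lambda>x. u x + w x) \<in> L2"
proof -
  have m [measurable]: "u \<in> borel_measurable lebesgue" "w \<in> borel_measurable lebesgue"
    and i: "integrable lebesgue (\<lambda>x. 2 * (cmod (u x))\<^sup>2 + 2 * (cmod (w x))\<^sup>2)"
    using assms by (auto simp: L2_def)
  have "(cmod (u x + w x))\<^sup>2 \<le> 2 * (cmod (u x))\<^sup>2 + 2 * (cmod (w x))\<^sup>2" for x
  proof -
    have "(cmod (u x + w x))\<^sup>2 \<le> (cmod (u x) + cmod (w x))\<^sup>2"
      by (intro power_mono norm_triangle_ineq) simp
    then show ?thesis
      using sum_squares_bound[of "cmod (u x)" "cmod (w x)"] by (simp add: power2_sum)
  qed
  then have "integrable lebesgue (\<lambda>x. (cmod (u x + w x))\<^sup>2)"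
    by (intro Bochner_Integration.integrable_bound[OF i]) (auto intro!: AE_I2)
  then show ?thesis by (simp add: L2_def)
qed

lemma L2_cmult:
  assumes "u \<in> L2"
  shows "(\<lambda>x. a * u x) \<in> L2"
  using assms by (auto simp: L2_def norm_mult power_mult_distrib)

lemma zero_in_L2: "(\<lambda>x. 0) \<in> L2"
  by (simp add: L2_def)


section \<open>The operator conjugated to Cauchy--Riemann\<close>

text \<open>
  The formal transpose: the derivatives change sign when they are moved to the test function.
\<close>

definition opL_transpose :: "real \<Rightarrow> real \<Rightarrow> real \<Rightarrow> real \<Rightarrow> real \<Rightarrow> plane_fun \<Rightarrow> plane_fun" where
  "opL_transpose lam1 lam2 c d \<mu>2 \<phi> = (\<lambda>x.
       of_real (lam2 * c * d - d * inverse lam1) * (of_real (fst x) * \<phi> x)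
     - of_real lam2 * D2 \<phi> x
     + \<i> * of_real (\<mu>2 * lam1 * inverse d) * D1 \<phi> x
     - \<i> * of_real (\<mu>2 * c * lam1) * (of_real (snd x) * \<phi> x))"

lemma test_fun_D1: "test_fun \<phi> \<Longrightarrow> test_fun (D1 \<phi>)"
  and test_fun_D2: "test_fun \<phi> \<Longrightarrow> test_fun (D2 \<phi>)"
  unfolding D1_def D2_def by (rule test_fun_cmult, erule test_fun_pd1 test_fun_pd2)+

lemma opL_dist_of_fun:
  assumes u: "u \<in> borel_measurable lebesgue" "u0 \<in> borel_measurable borel" "AE x in lebesgue. u x = u0 x"
    and lu0: "locally_integrable u0" and \<phi>: "test_fun \<phi>"
  shows "opL lam1 lam2 c d \<mu>2 (dist_of_fun u) \<phi>
    = (\<integral>x. u0 x * opL_transpose lam1 lam2 c d \<mu>2 \<phi> x \<partial>lborel)"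
proof -
  let ?T = "\<lambda>\<phi>. \<integral>x. u0 x * \<phi> x \<partial>lborel"
  define f1 where "f1 = (\<lambda>x. of_real (fst x) * \<phi> x)"
  define f2 where "f2 = (\<lambda>x. of_real (snd x) * \<phi> x)"
  note T = dist_of_fun_eq_lborel[OF u]
  have tf: "test_fun f1" "test_fun f2" "test_fun (D1 \<phi>)" "test_fun (D2 \<phi>)"
    using \<phi> unfolding f1_def f2_def
    by (auto intro: test_fun_mult smooth_fst smooth_snd test_fun_D1 test_fun_D2)
  note int = tf[THEN integrable_mult_test_fun[OF lu0]]
  have "opL lam1 lam2 c d \<mu>2 (dist_of_fun u) \<phi>
      = of_real (lam2 * c * d - d * inverse lam1) * ?T f1 - of_real lam2 * ?T (D2 \<phi>)
        + \<i> * of_real (\<mu>2 * lam1 * inverse d) * ?T (D1 \<phi>) - \<i> * of_real (\<mu>2 * c * lam1) * ?T f2"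
    unfolding opL_def dist_mult_def dist_D1_def dist_D2_def
    using T[OF tf(1)] T[OF tf(2)] T[OF tf(3)] T[OF tf(4)] by (simp add: f1_def f2_def)
  also have "\<dots> = (\<integral>x. of_real (lam2 * c * d - d * inverse lam1) * (u0 x * f1 x)
        - of_real lam2 * (u0 x * D2 \<phi> x)
        + \<i> * of_real (\<mu>2 * lam1 * inverse d) * (u0 x * D1 \<phi> x)
        - \<i> * of_real (\<mu>2 * c * lam1) * (u0 x * f2 x) \<partial>lborel)"
    using int by simp
  also have "\<dots> = (\<integral>x. u0 x * opL_transpose lam1 lam2 c d \<mu>2 \<phi> x \<partial>lborel)"
    unfolding opL_transpose_def f1_def f2_def
    by (rule Bochner_Integration.integral_cong) (simp_all add: algebra_simps)
  finally show ?thesis .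
qed

lemma dbar_exp_mult:
  assumes "has_pds \<Phi> p q x" "smooth \<phi>"
  shows "dbar b (\<lambda>x. exp (\<Phi> x) * \<phi> x) x = exp (\<Phi> x) * (dbar b \<phi> x + (p + \<i> / of_real b * q) * \<phi> x)"
  unfolding dbar_eqI[OF has_pds_mult[OF has_pds_compose[OF assms(1) DERIV_exp]
        smooth_imp_has_pds[OF assms(2)]]]
  by (simp add: dbar_def algebra_simps)

lemma dbar_holomorphic_mult:
  assumes "F holomorphic_on UNIV" "smooth \<psi>" "b \<noteq> 0"
  shows "dbar b (\<lambda>x. F (zeta b x) * \<psi> x) x = F (zeta b x) * dbar b \<psi> x"
proof -
  have F': "(F has_field_derivative deriv F z) (at z)" for z
    using assms(1) holomorphic_derivI by blast
  have "has_pds (zeta b) 1 (\<i> * of_real b) x"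
    using has_pds_add[OF has_pds_fst has_pds_mult[OF has_pds_const[of "\<i> * of_real b"] has_pds_snd], of x]
    by (simp add: zeta_def[abs_def] mult.assoc)
  from dbar_eqI[OF has_pds_mult[OF has_pds_compose[OF this F'] smooth_imp_has_pds[OF assms(2)]]]
  show ?thesis
    using assms(3) by (simp add: dbar_def field_simps)
qed

lemma smooth_zeta: "smooth (zeta b)"
  using smooth_add[OF smooth_fst smooth_mult[OF smooth_const[of "\<i> * of_real b"] smooth_snd]]
  by (simp add: zeta_def[abs_def] mult.assoc)

text \<open>
  Substituting \<open>\<phi> = exp (- \<Phi>) \<psi>\<close> is a bijection of the test functions, and turns the kernel condition for
  \<open>u\<close> into the weak equation \<open>dbar v = 0\<close> for \<open>v = u exp (- \<Phi>)\<close>.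
\<close>

lemma kernel_characterisation:
  assumes b: "b > 0" and k: "k \<noteq> 0" and \<Phi>: "smooth \<Phi>"
    and conj: "\<And>\<phi> x. test_fun \<phi> \<Longrightarrow> opL_transpose lam1 lam2 c d \<mu>2 \<phi> x
      = k * (exp (- \<Phi> x) * dbar b (\<lambda>x. exp (\<Phi> x) * \<phi> x) x)"
    and u: "u \<in> L2"
  shows "dist_of_fun u \<in> dist_ker (opL lam1 lam2 c d \<mu>2) \<longleftrightarrow>
    (\<exists>F. F holomorphic_on UNIV \<and> (AE x in lebesgue. u x = F (zeta b x) * exp (\<Phi> x)))"
proof -
  obtain u0 where u0: "u0 \<in> borel_measurable borel" "AE x in lebesgue. u x = u0 x"
    "integrable lborel (\<lambda>x. (cmod (u0 x))\<^sup>2)"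
    using L2_borel_representative[OF u] by blast
  have um: "u \<in> borel_measurable lebesgue" using u by (simp add: L2_def)
  have lu0: "locally_integrable u0"
    by (rule locally_integrable_if_square_integrable[OF u0(1,3)])
  have sE: "smooth (\<lambda>x. exp (\<Phi> x))" "smooth (\<lambda>x. exp (- \<Phi> x))"
    by (rule smooth_holomorphic_compose[OF \<Phi>], intro holomorphic_intros)+
  define v where "v = (\<lambda>x. u0 x * exp (- \<Phi> x))"
  have v: "locally_integrable v"
    unfolding v_def by (rule locally_integrable_mult_continuous[OF lu0 smooth_imp_continuous[OF sE(2)]])
  have opL: "opL lam1 lam2 c d \<mu>2 (dist_of_fun u) \<phi>
      = k * (\<integral>x. v x * dbar b (\<lambda>x. exp (\<Phi> x) * \<phi> x) x \<partial>lborel)" if "test_fun \<phi>" for \<phi>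
    unfolding opL_dist_of_fun[OF um u0(1,2) lu0 that] conj[OF that] v_def
      integral_mult_right_zero[symmetric] by (simp only: mult_ac)
  have "dist_of_fun u \<in> dist_ker (opL lam1 lam2 c d \<mu>2) \<longleftrightarrow> weakly_dbar_closed b v"
  proof
    assume ker: "dist_of_fun u \<in> dist_ker (opL lam1 lam2 c d \<mu>2)"
    show "weakly_dbar_closed b v"
      unfolding weakly_dbar_closed_def
    proof (intro allI impI)
      fix \<psi> assume "test_fun \<psi>"
      then have t: "test_fun (\<lambda>x. exp (- \<Phi> x) * \<psi> x)" by (rule test_fun_mult[OF sE(2)])
      with ker have "opL lam1 lam2 c d \<mu>2 (dist_of_fun u) (\<lambda>x. exp (- \<Phi> x) * \<psi> x) = 0"
        by (simp add: dist_ker_def)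
      moreover have "(\<lambda>x. exp (\<Phi> x) * (exp (- \<Phi> x) * \<psi> x)) = \<psi>"
        by (simp add: mult.assoc[symmetric] exp_minus)
      ultimately show "(\<integral>x. v x * dbar b \<psi> x \<partial>lborel) = 0"
        using k unfolding opL[OF t] by simp
    qed
  next
    assume "weakly_dbar_closed b v"
    then show "dist_of_fun u \<in> dist_ker (opL lam1 lam2 c d \<mu>2)"
      unfolding dist_ker_def weakly_dbar_closed_def
      using distribution_dist_of_fun[OF u] opL test_fun_mult[OF sE(1)] by simp
  qed
  also have "\<dots> \<longleftrightarrow> (\<exists>F. F holomorphic_on UNIV \<and> (AE x in lborel. v x = F (zeta b x)))"
  proof
    assume "weakly_dbar_closed b v"
    then show "\<exists>F. F holomorphic_on UNIV \<and> (AE x in lborel. v x = F (zeta b x))"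
      by (rule weyl_lemma[OF b v])
  next
    assume "\<exists>F. F holomorphic_on UNIV \<and> (AE x in lborel. v x = F (zeta b x))"
    then obtain F where F: "F holomorphic_on UNIV" "AE x in lborel. v x = F (zeta b x)" by blast
    have sF: "smooth (\<lambda>x. F (zeta b x))"
      by (rule smooth_holomorphic_compose[OF smooth_zeta F(1)])
    show "weakly_dbar_closed b v"
      unfolding weakly_dbar_closed_def
    proof (intro allI impI)
      fix \<psi> assume \<psi>: "test_fun \<psi>"
      have db: "dbar b (\<lambda>x. F (zeta b x) * \<psi> x) x = F (zeta b x) * dbar b \<psi> x" for x
        using b \<psi> by (intro dbar_holomorphic_mult[OF F(1)]) (auto simp: test_fun_def)
      have [measurable]: "dbar b \<psi> \<in> borel_measurable borel"
        unfolding dbar_def using test_fun_continuous[OF test_fun_pd1[OF \<psi>], of UNIV]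
          test_fun_continuous[OF test_fun_pd2[OF \<psi>], of UNIV]
        by (intro borel_measurable_continuous_onI continuous_intros)
      have "(\<integral>x. v x * dbar b \<psi> x \<partial>lborel) = (\<integral>x. F (zeta b x) * dbar b \<psi> x \<partial>lborel)"
      proof (rule integral_cong_AE)
        have [measurable]: "v \<in> borel_measurable borel"
          using v by (simp add: locally_integrable_def)
        show "(\<lambda>x. v x * dbar b \<psi> x) \<in> borel_measurable lborel"
          by measurable
        have [measurable]: "(\<lambda>x. F (zeta b x)) \<in> borel_measurable borel"
          by (rule borel_measurable_continuous_onI[OF smooth_imp_continuous[OF sF]])
        show "(\<lambda>x. F (zeta b x) * dbar b \<psi> x) \<in> borel_measurable lborel"
          by measurable
        show "AE x in lborel. v x * dbar b \<psi> x = F (zeta b x) * dbar b \<psi> x"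
          using F(2) by eventually_elim simp
      qed
      also have "\<dots> = 0"
        unfolding db[symmetric] by (rule integral_dbar_eq_0[OF test_fun_mult[OF sF \<psi>]])
      finally show "(\<integral>x. v x * dbar b \<psi> x \<partial>lborel) = 0" .
    qed
  qed
  also have "\<dots> \<longleftrightarrow> (\<exists>F. F holomorphic_on UNIV \<and> (AE x in lebesgue. u x = F (zeta b x) * exp (\<Phi> x)))"
  proof -
    have "(AE x in lborel. v x = F (zeta b x)) \<longleftrightarrow> (AE x in lebesgue. u x = F (zeta b x) * exp (\<Phi> x))" for F
    proof -
      have "(AE x in lborel. v x = F (zeta b x)) \<longleftrightarrow> (AE x in lebesgue. v x = F (zeta b x))"
        by (rule AE_completion_iff[symmetric])
      also have "\<dots> \<longleftrightarrow> (AE x in lebesgue. u x = F (zeta b x) * exp (\<Phi> x))"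
      proof (rule eventually_cong[OF u0(2)])
        fix x assume "u x = u0 x"
        then show "v x = F (zeta b x) \<longleftrightarrow> u x = F (zeta b x) * exp (\<Phi> x)"
          by (auto simp: v_def exp_minus field_simps)
      qed
      finally show ?thesis .
    qed
    then show ?thesis by simp
  qed
  finally show ?thesis .
qed

text \<open>
  Linearity is visible in the description by entire functions: the functions \<open>F\<close> form a vector space,
  whatever the common factor \<open>g\<close> is.
\<close>

lemma subspace_gaussian_space:
  "module.subspace (\<lambda>(a::complex) u x. a * u x)
    {u \<in> L2. \<exists>F. F holomorphic_on UNIV \<and> (AE x in lebesgue. u x = F (zeta b x) * g x)}"
proof -
  interpret module "\<lambda>(a::complex) (u::plane_fun) x. a * u x"
    by standard (auto simp: fun_eq_iff algebra_simps)
  show ?thesis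
  proof (rule subspaceI)
    show "0 \<in> {u \<in> L2. \<exists>F. F holomorphic_on UNIV \<and> (AE x in lebesgue. u x = F (zeta b x) * g x)}"
      using zero_in_L2 by (auto simp: zero_fun_def intro!: exI[of _ "\<lambda>z. 0"])
  next
    fix u w
    assume "u \<in> {u \<in> L2. \<exists>F. F holomorphic_on UNIV \<and> (AE x in lebesgue. u x = F (zeta b x) * g x)}"
      and "w \<in> {u \<in> L2. \<exists>F. F holomorphic_on UNIV \<and> (AE x in lebesgue. u x = F (zeta b x) * g x)}"
    then obtain F H where *: "u \<in> L2" "w \<in> L2" "F holomorphic_on UNIV" "H holomorphic_on UNIV"
      "AE x in lebesgue. u x = F (zeta b x) * g x" "AE x in lebesgue. w x = H (zeta b x) * g x"
      by blast
    have "AE x in lebesgue. (u + w) x = (F (zeta b x) + H (zeta b x)) * g x"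
      using *(5,6) by eventually_elim (simp add: algebra_simps)
    moreover have "(\<lambda>z. F z + H z) holomorphic_on UNIV"
      using *(3,4) by (rule holomorphic_on_add)
    moreover have "u + w \<in> L2" using L2_add[OF *(1,2)] by (simp add: plus_fun_def)
    ultimately show "u + w \<in> {u \<in> L2. \<exists>F. F holomorphic_on UNIV \<and> (AE x in lebesgue. u x = F (zeta b x) * g x)}"
      by (intro CollectI conjI exI[of _ "\<lambda>z. F z + H z"])
  next
    fix a u
    assume "u \<in> {u \<in> L2. \<exists>F. F holomorphic_on UNIV \<and> (AE x in lebesgue. u x = F (zeta b x) * g x)}"
    then obtain F where *: "u \<in> L2" "F holomorphic_on UNIV"
      "AE x in lebesgue. u x = F (zeta b x) * g x" by blast
    have "AE x in lebesgue. a * u x = (a * F (zeta b x)) * g x"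
      using *(3) by eventually_elim simp
    moreover have "(\<lambda>z. a * F z) holomorphic_on UNIV"
      using *(2) by (intro holomorphic_intros)
    ultimately show "(\<lambda>x. a * u x) \<in> {u \<in> L2. \<exists>F. F holomorphic_on UNIV \<and> (AE x in lebesgue. u x = F (zeta b x) * g x)}"
      using L2_cmult[OF *(1)] by (intro CollectI conjI exI[of _ "\<lambda>z. a * F z"])
  qed
qed

text \<open>
  The first identity makes the principal part of \<open>opL\<close> proportional to \<open>dbar\<close> with \<open>b = \<beta>2\<close>; the last
  two match the coefficients of \<open>x\<^sub>1\<close> and \<open>x\<^sub>2\<close> in \<open>opL\<close> with those in \<open>dbar\<close> of the phase.
\<close>

lemma coefficient_identities:
  fixes \<omega> \<nu> \<alpha> \<mu>2 \<gamma> \<beta>2 lam1 lam2 d c :: real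
  assumes \<omega>: "\<omega> > 0" and \<alpha>: "\<alpha> > 0" and \<mu>: "\<mu>2 > 0"
    and \<gamma>: "\<gamma> = 2 * \<alpha> / \<omega>"
    and \<beta>: "\<beta>2 = 2 * \<omega> * \<mu>2 / (\<alpha> + 2 * \<omega>\<^sup>2 + \<nu>\<^sup>2)"
    and l1: "lam1 > 0" "lam1\<^sup>2 = (\<alpha> - 2 * \<omega>\<^sup>2 + \<nu>\<^sup>2) / (2 * \<alpha>)"
    and l2: "lam2 > 0" "lam2\<^sup>2 = (\<alpha> + 2 * \<omega>\<^sup>2 + \<nu>\<^sup>2) / (2 * \<alpha>)"
    and d: "d = \<gamma> * lam1 * lam2 / 2"
    and c: "c = (lam1\<^sup>2 + lam2\<^sup>2) / (2 * lam1 * lam2)"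
  shows "\<beta>2 > 0" "d > 0" "\<gamma> > 0"
    and "lam2 * \<beta>2 = \<mu>2 * lam1 / d"
    and "4 * (lam2 * c * d - d * inverse lam1) = - (lam2 * \<gamma> * (1 - \<nu>\<^sup>2 / \<alpha>))"
    and "4 * d * (\<mu>2 * c * lam1) = \<mu>2 * lam1 * (\<gamma> * (1 + \<nu>\<^sup>2 / \<alpha>))"
proof -
  have S: "\<alpha> + 2 * \<omega>\<^sup>2 + \<nu>\<^sup>2 > 0"
    using \<alpha> zero_le_power2[of \<omega>] zero_le_power2[of \<nu>] by linarith
  show \<beta>0: "\<beta>2 > 0" using S \<omega> \<mu> by (simp add: \<beta>)
  show \<gamma>0: "\<gamma> > 0" using \<omega> \<alpha> by (simp add: \<gamma>)
  show d0: "d > 0" using \<gamma>0 l1(1) l2(1) by (simp add: d)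
  have S2: "\<alpha> + 2 * \<omega>\<^sup>2 + \<nu>\<^sup>2 = 2 * \<alpha> * lam2\<^sup>2" using \<alpha> l2(2) by (simp add: field_simps)
  have b: "\<beta>2 = \<omega> * \<mu>2 / (\<alpha> * lam2\<^sup>2)"
    unfolding \<beta> S2 using \<alpha> l2(1) by (simp add: field_simps)
  have d': "d = \<alpha> * lam1 * lam2 / \<omega>" by (simp add: d \<gamma>)
  show "lam2 * \<beta>2 = \<mu>2 * lam1 / d"
    unfolding b d' using \<alpha> l1(1) l2(1) \<omega> by (simp add: field_simps power2_eq_square)
  have sum: "lam1\<^sup>2 + lam2\<^sup>2 = 1 + \<nu>\<^sup>2 / \<alpha>"
    unfolding l1(2) l2(2) using \<alpha> by (simp add: field_simps)
  have cd: "c * d = \<gamma> * (1 + \<nu>\<^sup>2 / \<alpha>) / 4"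
    unfolding c d sum using l1(1) l2(1) by (simp add: field_simps)
  have "d * inverse lam1 = \<gamma> * lam2 / 2" unfolding d using l1(1) by (simp add: field_simps)
  then have "4 * (lam2 * c * d - d * inverse lam1) = 4 * (lam2 * (c * d)) - 2 * (\<gamma> * lam2)"
    by simp
  also have "\<dots> = - (lam2 * \<gamma> * (1 - \<nu>\<^sup>2 / \<alpha>))" unfolding cd by (simp add: algebra_simps)
  finally show "4 * (lam2 * c * d - d * inverse lam1) = - (lam2 * \<gamma> * (1 - \<nu>\<^sup>2 / \<alpha>))" .
  have "4 * d * (\<mu>2 * c * lam1) = 4 * (\<mu>2 * lam1 * (c * d))" by simp
  also have "\<dots> = \<mu>2 * lam1 * (\<gamma> * (1 + \<nu>\<^sup>2 / \<alpha>))" unfolding cd by simp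
  finally show "4 * d * (\<mu>2 * c * lam1) = \<mu>2 * lam1 * (\<gamma> * (1 + \<nu>\<^sup>2 / \<alpha>))" .
qed

definition phase_partial1 :: "real \<Rightarrow> real \<Rightarrow> real \<Rightarrow> real \<Rightarrow> plane_fun" where
  "phase_partial1 \<nu> \<alpha> \<beta>2 \<gamma> x = of_real (- (\<gamma> * pi / (2 * \<beta>2)) * (1 - \<nu>\<^sup>2 / (2 * \<alpha>)) * fst x)
     - \<i> * of_real (pi * \<nu>\<^sup>2 * \<gamma> / (4 * \<alpha>) * snd x)"

definition phase_partial2 :: "real \<Rightarrow> real \<Rightarrow> real \<Rightarrow> real \<Rightarrow> plane_fun" where
  "phase_partial2 \<nu> \<alpha> \<beta>2 \<gamma> x = of_real (- (\<gamma> * pi * \<beta>2 / 2) * (1 + \<nu>\<^sup>2 / (2 * \<alpha>)) * snd x)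
     - \<i> * of_real (pi * \<nu>\<^sup>2 * \<gamma> / (4 * \<alpha>) * fst x)"

lemma smooth_phase: "smooth (\<lambda>x. phase1 \<nu> \<alpha> \<beta>2 \<gamma> x + phase2 \<nu> \<alpha> \<gamma> x)"
proof -
  have "smooth (\<lambda>x. of_real (- (\<gamma> * pi / (4 * \<beta>2)) * (1 - \<nu>\<^sup>2 / (2 * \<alpha>))) * (of_real (fst x) * of_real (fst x))
    + (of_real (- (\<gamma> * pi / (4 * \<beta>2)) * \<beta>2\<^sup>2 * (1 + \<nu>\<^sup>2 / (2 * \<alpha>))) * (of_real (snd x) * of_real (snd x))
    + (- \<i> * of_real (pi * \<nu>\<^sup>2 * \<gamma> / (4 * \<alpha>))) * (of_real (fst x) * of_real (snd x))))"
    by (intro smooth_add smooth_mult smooth_const smooth_fst smooth_snd)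
  then show ?thesis
    by (rule back_subst[of smooth])
       (simp add: fun_eq_iff phase1_def phase2_def power2_eq_square algebra_simps)
qed

lemma has_pds_phase:
  assumes "\<beta>2 > 0"
  shows "has_pds (\<lambda>x. phase1 \<nu> \<alpha> \<beta>2 \<gamma> x + phase2 \<nu> \<alpha> \<gamma> x)
    (phase_partial1 \<nu> \<alpha> \<beta>2 \<gamma> x) (phase_partial2 \<nu> \<alpha> \<beta>2 \<gamma> x) x"
proof -
  define p where "p = - (\<gamma> * pi / (4 * \<beta>2)) * (1 - \<nu>\<^sup>2 / (2 * \<alpha>))"
  define q where "q = - (\<gamma> * pi / (4 * \<beta>2)) * \<beta>2\<^sup>2 * (1 + \<nu>\<^sup>2 / (2 * \<alpha>))"
  define r where "r = - (pi * \<nu>\<^sup>2 * \<gamma> / (4 * \<alpha>))"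
  have 1: "(\<lambda>x. phase1 \<nu> \<alpha> \<beta>2 \<gamma> x + phase2 \<nu> \<alpha> \<gamma> x) =
      (\<lambda>x. of_real p * (of_real (fst x) * of_real (fst x))
        + (of_real q * (of_real (snd x) * of_real (snd x))
        + (\<i> * of_real r) * (of_real (fst x) * of_real (snd x))))"
    by (simp add: fun_eq_iff p_def q_def r_def phase1_def phase2_def power2_eq_square algebra_simps)
  have 2: "phase_partial1 \<nu> \<alpha> \<beta>2 \<gamma> x = of_real (2 * p * fst x) + \<i> * of_real (r * snd x)"
    unfolding phase_partial1_def p_def r_def using assms by (simp add: field_simps)
  have 3: "phase_partial2 \<nu> \<alpha> \<beta>2 \<gamma> x = of_real (2 * q * snd x) + \<i> * of_real (r * fst x)"
    unfolding phase_partial2_def q_def r_def using assms by (simp add: field_simps power2_eq_square)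
  show ?thesis
    unfolding 1 2 3
    using has_pds_add[OF has_pds_mult[OF has_pds_const[of "of_real p"] has_pds_mult[OF has_pds_fst has_pds_fst]]
        has_pds_add[OF has_pds_mult[OF has_pds_const[of "of_real q"] has_pds_mult[OF has_pds_snd has_pds_snd]]
          has_pds_mult[OF has_pds_const[of "\<i> * of_real r"] has_pds_mult[OF has_pds_fst has_pds_snd]]], of x]
    by (simp add: algebra_simps)
qed

text \<open>
  By the product rule \<open>exp (- \<Phi>) dbar (exp \<Phi> \<phi>) = dbar \<phi> + (dbar \<Phi>) \<phi>\<close>, and \<open>dbar \<Phi>\<close> is linear: the mixed
  term of the phase turns the factors \<open>1 - \<nu>\<^sup>2 / (2 \<alpha>)\<close> and \<open>1 + \<nu>\<^sup>2 / (2 \<alpha>)\<close> of \<open>x\<^sub>1\<close> and \<open>x\<^sub>2\<close> into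
  \<open>1 - \<nu>\<^sup>2 / \<alpha>\<close> and \<open>1 + \<nu>\<^sup>2 / \<alpha>\<close>.
\<close>

lemma opL_transpose_conjugation:
  fixes \<omega> \<nu> \<alpha> \<mu>2 \<gamma> \<beta>2 lam1 lam2 d c :: real
  assumes pos: "\<beta>2 > 0" "d > 0" "lam1 > 0" "lam2 > 0" "\<alpha> > 0"
    and b: "lam2 * \<beta>2 = \<mu>2 * lam1 / d"
    and x1: "4 * (lam2 * c * d - d * inverse lam1) = - (lam2 * \<gamma> * (1 - \<nu>\<^sup>2 / \<alpha>))"
    and x2: "4 * d * (\<mu>2 * c * lam1) = \<mu>2 * lam1 * (\<gamma> * (1 + \<nu>\<^sup>2 / \<alpha>))"
    and \<phi>: "smooth \<phi>"
  defines "\<Phi> \<equiv> \<lambda>x. phase1 \<nu> \<alpha> \<beta>2 \<gamma> x + phase2 \<nu> \<alpha> \<gamma> x"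
  shows "opL_transpose lam1 lam2 c d \<mu>2 \<phi> x
      = of_real (lam2 * \<beta>2 / (2 * pi)) * (exp (- \<Phi> x) * dbar \<beta>2 (\<lambda>x. exp (\<Phi> x) * \<phi> x) x)"
proof -
  have mu: "\<mu>2 * lam1 = d * lam2 * \<beta>2" using b pos by (simp add: field_simps)
  have A: "lam2 * c * d - d * inverse lam1 = - (lam2 * \<gamma> * (1 - \<nu>\<^sup>2 / \<alpha>)) / 4"
    unfolding x1[symmetric] by simp
  have C: "\<mu>2 * c * lam1 = lam2 * \<beta>2 * (\<gamma> * (1 + \<nu>\<^sup>2 / \<alpha>)) / 4"
  proof -
    have "d * (4 * (\<mu>2 * c * lam1)) = d * (lam2 * \<beta>2 * (\<gamma> * (1 + \<nu>\<^sup>2 / \<alpha>)))"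
      using x2 unfolding mu by (simp only: mult_ac)
    then have "4 * (\<mu>2 * c * lam1) = lam2 * \<beta>2 * (\<gamma> * (1 + \<nu>\<^sup>2 / \<alpha>))"
      by (rule mult_left_cancel[THEN iffD1, rotated]) (use pos(2) in simp)
    then show ?thesis by simp
  qed
  have M: "\<mu>2 * lam1 * inverse d = lam2 * \<beta>2" unfolding mu using pos by (simp add: field_simps)
  have P: "phase_partial1 \<nu> \<alpha> \<beta>2 \<gamma> x + \<i> / of_real \<beta>2 * phase_partial2 \<nu> \<alpha> \<beta>2 \<gamma> x
      = of_real (- (\<gamma> * pi / (2 * \<beta>2)) * (1 - \<nu>\<^sup>2 / \<alpha>) * fst x)
        - \<i> * of_real (\<gamma> * pi / 2 * (1 + \<nu>\<^sup>2 / \<alpha>) * snd x)"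
    unfolding phase_partial1_def phase_partial2_def using pos
    by (simp add: complex_eq_iff field_simps)
  have "exp (- \<Phi> x) * dbar \<beta>2 (\<lambda>x. exp (\<Phi> x) * \<phi> x) x = dbar \<beta>2 \<phi> x
      + (phase_partial1 \<nu> \<alpha> \<beta>2 \<gamma> x + \<i> / of_real \<beta>2 * phase_partial2 \<nu> \<alpha> \<beta>2 \<gamma> x) * \<phi> x"
  proof -
    have pds: "has_pds \<Phi> (phase_partial1 \<nu> \<alpha> \<beta>2 \<gamma> x) (phase_partial2 \<nu> \<alpha> \<beta>2 \<gamma> x) x"
      unfolding \<Phi>_def by (rule has_pds_phase[OF pos(1)])
    have e: "exp (- \<Phi> x) * exp (\<Phi> x) = 1" by (simp add: exp_minus)
    show ?thesis
      unfolding dbar_exp_mult[OF pds \<phi>] mult.assoc[symmetric] e by simp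
  qed
  also have "of_real (lam2 * \<beta>2 / (2 * pi)) * \<dots> = opL_transpose lam1 lam2 c d \<mu>2 \<phi> x"
    unfolding P opL_transpose_def A C M D1_def D2_def dbar_def using pos
    by (simp add: field_simps)
  finally show ?thesis by simp
qed

text \<open>
  The second exponent is purely imaginary, so the form is diagonal, and \<open>\<nu>\<^sup>2 / (2 \<alpha>) \<le> 1 / 2\<close> makes both
  coefficients negative.
\<close>

lemma neg_def_phase:
  assumes "\<gamma> > 0" "\<beta>2 > 0" "\<nu>\<^sup>2 \<le> \<alpha>" "\<alpha> > 0"
  shows "neg_def_quadratic_form (\<lambda>x. Re (phase1 \<nu> \<alpha> \<beta>2 \<gamma> x + phase2 \<nu> \<alpha> \<gamma> x))"
proof -
  define s where "s = \<gamma> * pi / (4 * \<beta>2)"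
  define t where "t = \<nu>\<^sup>2 / (2 * \<alpha>)"
  have s: "s > 0" and t: "0 \<le> t" "t < 1"
    using assms by (simp_all add: s_def t_def)
  define p where "p = - s * (1 - t)"
  define q where "q = - s * \<beta>2\<^sup>2 * (1 + t)"
  have re: "Re (phase1 \<nu> \<alpha> \<beta>2 \<gamma> x + phase2 \<nu> \<alpha> \<gamma> x) = p * (fst x)\<^sup>2 + q * (snd x)\<^sup>2" for x
    unfolding phase1_def phase2_def s_def[symmetric] t_def[symmetric]
    by (simp add: p_def q_def power_mult_distrib algebra_simps)
  have pq: "p < 0" "q < 0"
    using s t assms(2) unfolding p_def q_def by (intro mult_neg_pos; simp)+
  define B where "B = (\<lambda>x y :: real \<times> real. p * fst x * fst y + q * snd x * snd y)"
  have "bilinear B"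
    unfolding bilinear_def B_def by (auto intro!: linearI simp: algebra_simps)
  moreover have "\<forall>x y. B x y = B y x" by (auto simp: B_def)
  moreover have "\<forall>x. p * (fst x)\<^sup>2 + q * (snd x)\<^sup>2 = B x x"
    by (auto simp: B_def power2_eq_square)
  moreover have "p * (fst x)\<^sup>2 + q * (snd x)\<^sup>2 < 0" if "x \<noteq> 0" for x :: "real \<times> real"
  proof -
    have "p * (fst x)\<^sup>2 \<le> 0" "q * (snd x)\<^sup>2 \<le> 0"
      using pq by (simp_all add: mult_nonpos_nonneg)
    moreover have "fst x \<noteq> 0 \<or> snd x \<noteq> 0" using that by (auto simp: prod_eq_iff)
    then have "p * (fst x)\<^sup>2 < 0 \<or> q * (snd x)\<^sup>2 < 0"
      using pq by (auto intro!: mult_neg_pos)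
    ultimately show ?thesis by linarith
  qed
  ultimately show ?thesis
    unfolding neg_def_quadratic_form_def re by blast
qed

theorem proposition4p5:
  fixes \<omega> \<nu> \<epsilon> \<alpha> \<mu>2 \<gamma> \<beta>2 lam1 lam2 d c :: real
  assumes "\<omega> > 0" and "\<nu> \<ge> 0" and "\<epsilon> > 0"
    and "\<omega>\<^sup>2 + \<nu>\<^sup>2 + \<epsilon>\<^sup>2 = 1"
    and "\<alpha> = sqrt (\<nu> ^ 4 + 4 * \<omega>\<^sup>2)"
    and "\<mu>2 = sqrt (1 + \<omega>\<^sup>2 + \<alpha>)"
    and "\<gamma> = 2 * \<alpha> / \<omega>"
    and "\<beta>2 = 2 * \<omega> * \<mu>2 / (\<alpha> + 2 * \<omega>\<^sup>2 + \<nu>\<^sup>2)"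
    and "lam1 > 0" and "lam1\<^sup>2 = (\<alpha> - 2 * \<omega>\<^sup>2 + \<nu>\<^sup>2) / (2 * \<alpha>)"
    and "lam2 > 0" and "lam2\<^sup>2 = (\<alpha> + 2 * \<omega>\<^sup>2 + \<nu>\<^sup>2) / (2 * \<alpha>)"
    and "d = \<gamma> * lam1 * lam2 / 2"
    and "c = (lam1\<^sup>2 + lam2\<^sup>2) / (2 * lam1 * lam2)"
  shows "module.subspace (\<lambda>(a::complex) u x. a * u x) (LLL lam1 lam2 c d \<mu>2) \<and>
    LLL lam1 lam2 c d \<mu>2 =
      {u \<in> L2. \<exists>F. F holomorphic_on UNIV \<and>
         (AE x in lebesgue.
            u x = F (of_real (fst x) + \<i> * of_real (\<beta>2 * snd x))
                    * exp (phase1 \<nu> \<alpha> \<beta>2 \<gamma> x) * exp (phase2 \<nu> \<alpha> \<gamma> x))} \<and>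
    ((\<omega>, \<nu>) \<noteq> (0, 0) \<longrightarrow>
      neg_def_quadratic_form (\<lambda>x. Re (phase1 \<nu> \<alpha> \<beta>2 \<gamma> x + phase2 \<nu> \<alpha> \<gamma> x)))"
proof -
  have "\<nu> ^ 4 + 4 * \<omega>\<^sup>2 > 0" using assms(1) by (intro add_nonneg_pos) auto
  then have \<alpha>: "\<alpha> > 0" unfolding assms(5) by simp
  have \<mu>: "\<mu>2 > 0" unfolding assms(6) using \<alpha> by (simp add: add_nonneg_pos)
  have "\<nu>\<^sup>2 = sqrt (\<nu> ^ 4)"
    by (rule real_sqrt_unique[symmetric]) (simp_all flip: power_mult)
  also have "\<dots> \<le> \<alpha>" unfolding assms(5) by simp
  finally have \<nu>\<alpha>: "\<nu>\<^sup>2 \<le> \<alpha>" .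
  note ids = coefficient_identities[OF assms(1) \<alpha> \<mu> assms(7-14)]
  define \<Phi> where "\<Phi> = (\<lambda>x. phase1 \<nu> \<alpha> \<beta>2 \<gamma> x + phase2 \<nu> \<alpha> \<gamma> x)"
  define k where "k = complex_of_real (lam2 * \<beta>2 / (2 * pi))"
  have "k \<noteq> 0" using ids(1) assms(11) by (simp add: k_def)
  moreover have "opL_transpose lam1 lam2 c d \<mu>2 \<phi> x
      = k * (exp (- \<Phi> x) * dbar \<beta>2 (\<lambda>x. exp (\<Phi> x) * \<phi> x) x)" if "test_fun \<phi>" for \<phi> x
    unfolding k_def \<Phi>_def
    using opL_transpose_conjugation[OF ids(1,2) assms(9,11) \<alpha> ids(4-6)] that
    by (simp add: test_fun_def)
  ultimately have "dist_of_fun u \<in> dist_ker (opL lam1 lam2 c d \<mu>2) \<longleftrightarrow>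
      (\<exists>F. F holomorphic_on UNIV \<and> (AE x in lebesgue. u x = F (zeta \<beta>2 x) * exp (\<Phi> x)))"
    if "u \<in> L2" for u
    using kernel_characterisation[OF ids(1) _ _ _ that, of k \<Phi>] smooth_phase
    unfolding \<Phi>_def by blast
  then have LLL: "LLL lam1 lam2 c d \<mu>2 =
      {u \<in> L2. \<exists>F. F holomorphic_on UNIV \<and> (AE x in lebesgue. u x = F (zeta \<beta>2 x) * exp (\<Phi> x))}"
    unfolding LLL_def by blast
  have sub: "module.subspace (\<lambda>(a::complex) u x. a * u x) (LLL lam1 lam2 c d \<mu>2)"
    unfolding LLL by (rule subspace_gaussian_space)
  have "F (zeta \<beta>2 x) * exp (\<Phi> x) = F (of_real (fst x) + \<i> * of_real (\<beta>2 * snd x))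
      * exp (phase1 \<nu> \<alpha> \<beta>2 \<gamma> x) * exp (phase2 \<nu> \<alpha> \<gamma> x)" for F :: "complex \<Rightarrow> complex" and x
    by (simp add: zeta_def \<Phi>_def exp_add mult.assoc)
  with sub LLL neg_def_phase[OF ids(3,1) \<nu>\<alpha> \<alpha>] show ?thesis by simp
qed


end
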